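(* Let $a_i^\pm,b_i^\pm,c_i^\pm,d_i^\pm\in\mathbb R$ for $i=1,2,3$, and consider the discontinuous piecewise linear differential system in $\mathbb R^3$ $$\begin{pmatrix}\dot u\\ \dot v\\ \dot w\end{pmatrix}=\begin{cases}\begin{pmatrix}-v+\varepsilon(a_1^++b_1^+u+c_1^+v+d_1^+w)\\ u+\varepsilon(a_2^++b_2^+u+c_2^+v+d_2^+w)\\ w+\varepsilon(a_3^++b_3^+u+c_3^+v+d_3^+w)\end{pmatrix}&\text{if }v>0,\\[6pt] \begin{pmatrix}-v+\varepsilon(a_1^-+b_1^-u+c_1^-v+d_1^-w)\\ u+\varepsilon(a_2^-+b_2^-u+c_2^-v+d_2^-w)\\ w+\varepsilon(a_3^-+b_3^-u+c_3^-v+d_3^-w)\end{pmatrix}&\text{if }v<0.\end{cases}$$ If $(a_2^--a_2^+)(b_1^-+b_1^++c_2^-+c_2^+)>0$, then for $|\varepsilon|>0$ sufficiently small there exists a periodic solution $(u(t,\varepsilon),v(t,\varepsilon),w(t,\varepsilon))$ of this system such that $w(0,\varepsilon)\to0$ when $\varepsilon\to0$. Moreover, one can find $(u^*,v^* )\in\mathbb R^2$ such that $$\|(u^*,v^* )\|=\frac{4(a_2^--a_2^+)}{\pi(b_1^-+b_1^++c_2^-+c_2^+)}$$ and $(u(0,\varepsilon),v(0,\varepsilon))\to(u^*,v^* )$ when $\varepsilon\to0$.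
   Context: Solutions of the discontinuous system are understood in the sense of Filippov: a trajectory reaching the plane $\{v=0\}$ at a point where both vector fields point transversally to the same side of the plane crosses it, and is the concatenation of the trajectories of the two vector fields. $\|\cdot\|$ is the Euclidean norm. *)

theory Defs
  imports "HOL-Analysis.Analysis"
begin

section \<open>Filippov solutions of discontinuous autonomous systems\<close>

text \<open>
  The Filippov set-valued map of a vector field. The intersection over all null sets makes it
  independent of the values of the field on any set of measure zero.
\<close>

definition filippov_map :: "('a::euclidean_space \<Rightarrow> 'a) \<Rightarrow> 'a \<Rightarrow> 'a set" where
  "filippov_map f x =
     (\<Inter>\<delta>\<in>{0<..}. \<Inter>N\<in>{N. negligible N}. closure (convex hull (f ` (ball x \<delta> - N))))"

text \<open>
  The elements of the division \<open>D\<close> are nonempty compact intervals \<open>{Inf k..Sup k}\<close> with disjoint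
  interiors.
\<close>

definition absolutely_continuous_on :: "real set \<Rightarrow> (real \<Rightarrow> 'a::real_normed_vector) \<Rightarrow> bool" where
  "absolutely_continuous_on S x \<longleftrightarrow>
     (\<forall>e>0. \<exists>d>0. \<forall>D. D division_of \<Union>D \<longrightarrow> \<Union>D \<subseteq> S \<longrightarrow> (\<Sum>k\<in>D. Sup k - Inf k) < d \<longrightarrow>
        (\<Sum>k\<in>D. norm (x (Sup k) - x (Inf k))) < e)"

text \<open>
  Only solutions defined for all times are needed here.
\<close>

definition filippov_solution :: "('a::euclidean_space \<Rightarrow> 'a) \<Rightarrow> (real \<Rightarrow> 'a) \<Rightarrow> bool" where
  "filippov_solution f x \<longleftrightarrow>
     (\<forall>a b. absolutely_continuous_on {a..b} x) \<and>
     (AE t in lebesgue. \<exists>y\<in>filippov_map f (x t). (x has_vector_derivative y) (at t))"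

definition periodic_solution :: "('a::euclidean_space \<Rightarrow> 'a) \<Rightarrow> (real \<Rightarrow> 'a) \<Rightarrow> bool" where
  "periodic_solution f x \<longleftrightarrow>
     filippov_solution f x \<and> (\<exists>T>0. \<forall>t. x (t + T) = x t) \<and> (\<exists>s t. x s \<noteq> x t)"

section \<open>The piecewise linear system\<close>

text \<open>
  A point of \<open>real^3\<close> is \<open>(u, v, w)\<close>, and \<open>a$i\<close>, \<open>b$i\<close>, \<open>c$i\<close>, \<open>d$i\<close> are the coefficients of the
  perturbation in the \<open>i\<close>-th equation.
\<close>

definition linear_field :: "real \<Rightarrow> real^3 \<Rightarrow> real^3 \<Rightarrow> real^3 \<Rightarrow> real^3 \<Rightarrow> real^3 \<Rightarrow> real^3" where
  "linear_field \<epsilon> a b c d x =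
     (let u = x$1; v = x$2; w = x$3 in
        vector [- v + \<epsilon> * (a$1 + b$1 * u + c$1 * v + d$1 * w),
                u + \<epsilon> * (a$2 + b$2 * u + c$2 * v + d$2 * w),
                w + \<epsilon> * (a$3 + b$3 * u + c$3 * v + d$3 * w)])"

text \<open>
  The field is left unspecified on the null set \<open>v = 0\<close>, which does not affect its Filippov
  solutions.
\<close>

definition switched_field :: "(real^3 \<Rightarrow> real^3) \<Rightarrow> (real^3 \<Rightarrow> real^3) \<Rightarrow> real^3 \<Rightarrow> real^3" where
  "switched_field F G x = (if x$2 > 0 then F x else if x$2 < 0 then G x else undefined)"

section \<open>The Filippov map of a switched field\<close>

lemma filippov_map_supset:
  assumes U: "open U" "x \<in> closure U" and fg: "\<And>y. y \<in> U \<Longrightarrow> f y = g y" and g: "isCont g x"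
  shows "g x \<in> filippov_map f x"
proof -
  have "g x \<in> closure (f ` (ball x \<delta> - N))" if "\<delta> > 0" "negligible N" for \<delta> N
    unfolding closure_approachable
  proof (intro allI impI)
    fix e :: real assume "e > 0"
    then obtain d where d: "d > 0" "\<And>y. dist y x < d \<Longrightarrow> dist (g y) (g x) < e"
      using g unfolding continuous_at_eps_delta by blast
    let ?W = "U \<inter> ball x (min d \<delta>)"
    obtain z where "z \<in> U" "dist z x < min d \<delta>"
      using U(2) d(1) \<open>\<delta> > 0\<close> unfolding closure_approachable by (metis min_less_iff_conj)
    then have "?W \<noteq> {}" by (auto simp: dist_commute)
    moreover have "open ?W" using U(1) by blast
    ultimately have "\<not> negligible ?W" using open_not_negligible by blast
    then obtain y where y: "y \<in> ?W" "y \<notin> N"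
      using \<open>negligible N\<close> negligible_subset by blast
    then have "y \<in> ball x \<delta> - N" "dist (f y) (g x) < e"
      using fg[of y] d(2)[of y] by (auto simp: dist_commute)
    then show "\<exists>z\<in>f ` (ball x \<delta> - N). dist z (g x) < e" by blast
  qed
  moreover have "closure A \<subseteq> closure (convex hull A)" for A :: "'a set"
    by (simp add: closure_mono hull_subset)
  ultimately show ?thesis unfolding filippov_map_def by blast
qed

lemma filippov_map_subset:
  assumes K: "compact K" "convex K"
    and near: "\<And>e. e > 0 \<Longrightarrow> \<exists>\<delta>>0. \<exists>N. negligible N \<and>
                 (\<forall>y\<in>ball x \<delta> - N. \<exists>k\<in>K. dist k (f y) \<le> e)"
  shows "filippov_map f x \<subseteq> K"
proof
  fix y assume y: "y \<in> filippov_map f x"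
  have "\<exists>z\<in>K. dist z y < e" if "e > 0" for e
  proof -
    let ?K = "{k + h |k h. k \<in> K \<and> h \<in> cball 0 (e / 2)}"
    obtain \<delta> N where \<delta>: "\<delta> > 0" "negligible N" "\<forall>y\<in>ball x \<delta> - N. \<exists>k\<in>K. dist k (f y) \<le> e / 2"
      using near[of "e / 2"] \<open>e > 0\<close> by auto
    have "f ` (ball x \<delta> - N) \<subseteq> ?K"
    proof clarify
      fix y assume "y \<in> ball x \<delta>" "y \<notin> N"
      then obtain k where "k \<in> K" "dist k (f y) \<le> e / 2" using \<delta>(3) by blast
      then show "\<exists>k h. f y = k + h \<and> k \<in> K \<and> h \<in> cball 0 (e / 2)"
        by (intro exI[of _ k] exI[of _ "f y - k"]) (auto simp: dist_norm norm_minus_commute)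
    qed
    moreover have "convex ?K"
      using convex_sums[OF K(2) convex_cball[of 0 "e / 2"]] by (rule back_subst[of convex]) blast
    moreover have "closed ?K"
      by (intro compact_imp_closed compact_sums K(1) compact_cball)
    ultimately have "closure (convex hull (f ` (ball x \<delta> - N))) \<subseteq> ?K"
      by (intro closure_minimal hull_minimal) auto
    moreover have "y \<in> closure (convex hull (f ` (ball x \<delta> - N)))"
      using y \<delta>(1,2) unfolding filippov_map_def by auto
    ultimately obtain k h where "y = k + h" "k \<in> K" "norm h \<le> e / 2" by auto
    then show ?thesis using \<open>e > 0\<close> by (intro bexI[of _ k]) (auto simp: dist_norm)
  qed
  then show "y \<in> K"
    using compact_imp_closed[OF K(1)] closure_approachable[of y K] by (simp add: closure_closed)
qed

lemma filippov_map_continuous: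
  assumes U: "open U" "x \<in> U" and fg: "\<And>y. y \<in> U \<Longrightarrow> f y = g y" and g: "isCont g x"
  shows "filippov_map f x = {g x}"
proof
  show "{g x} \<subseteq> filippov_map f x"
    using filippov_map_supset[OF U(1) _ fg g] U(2) closure_subset by blast
  show "filippov_map f x \<subseteq> {g x}"
  proof (rule filippov_map_subset)
    fix e :: real assume "e > 0"
    then obtain d where d: "d > 0" "\<And>y. dist y x < d \<Longrightarrow> dist (g y) (g x) < e"
      using g unfolding continuous_at_eps_delta by blast
    obtain r where r: "r > 0" "ball x r \<subseteq> U" using U by (meson openE)
    have "dist (g x) (f y) \<le> e" if "y \<in> ball x (min d r)" for y
      using that d(2)[of y] r(2) fg[of y] by (auto simp: dist_commute intro: less_imp_le)
    then show "\<exists>\<delta>>0. \<exists>N. negligible N \<and> (\<forall>y\<in>ball x \<delta> - N. \<exists>k\<in>{g x}. dist k (f y) \<le> e)"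
      using d(1) r(1) by (intro exI[of _ "min d r"] conjI exI[of _ "{}"]) auto
  qed auto
qed

lemma filippov_map_switched_pos:
  assumes "x$2 > 0" "isCont F x"
  shows "filippov_map (switched_field F G) x = {F x}"
  by (rule filippov_map_continuous[where U = "{y. y$2 > 0}"])
     (use assms in \<open>auto simp: switched_field_def open_halfspace_component_gt_cart\<close>)

lemma filippov_map_switched_neg:
  assumes "x$2 < 0" "isCont G x"
  shows "filippov_map (switched_field F G) x = {G x}"
  by (rule filippov_map_continuous[where U = "{y. y$2 < 0}"])
     (use assms in \<open>auto simp: switched_field_def open_halfspace_component_lt_cart\<close>)

lemma filippov_map_switched_zero:
  assumes x: "x$2 = 0" and F: "isCont F x" and G: "isCont G x"
  shows "filippov_map (switched_field F G) x = closed_segment (F x) (G x)"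
proof
  have appr: "\<exists>y. s * (y$2) > 0 \<and> dist y x < e" if "e > 0" "s = 1 \<or> s = -1" for e s :: real
  proof -
    let ?h = "(s * (e / 2)) *\<^sub>R axis 2 1 :: real^3"
    have "norm ?h < e" using that by auto
    moreover have "s * (?h$2) > 0" using that by (auto simp: axis_def)
    ultimately show ?thesis using x by (intro exI[of _ "x + ?h"]) (auto simp: dist_norm)
  qed
  have "x \<in> closure {y. y$2 > 0}" "x \<in> closure {y. y$2 < 0}"
    unfolding closure_approachable using appr[of _ 1] appr[of _ "-1"] by auto
  then have "F x \<in> filippov_map (switched_field F G) x"
    and "G x \<in> filippov_map (switched_field F G) x"
    using filippov_map_supset[of "{y. y$2 > 0}" x "switched_field F G" F]
      filippov_map_supset[of "{y. y$2 < 0}" x "switched_field F G" G] F G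
    by (auto simp: switched_field_def open_halfspace_component_gt_cart
        open_halfspace_component_lt_cart)
  moreover have "convex (filippov_map (switched_field F G) x)"
    unfolding filippov_map_def by (intro convex_INT convex_closure convex_convex_hull)
  ultimately show "closed_segment (F x) (G x) \<subseteq> filippov_map (switched_field F G) x"
    by (rule closed_segment_subset)
  show "filippov_map (switched_field F G) x \<subseteq> closed_segment (F x) (G x)"
  proof (rule filippov_map_subset)
    fix e :: real assume e: "e > 0"
    obtain p where p: "p > 0" "\<And>y. dist y x < p \<Longrightarrow> dist (F y) (F x) < e"
      using F e unfolding continuous_at_eps_delta by blast
    obtain q where q: "q > 0" "\<And>y. dist y x < q \<Longrightarrow> dist (G y) (G x) < e"
      using G e unfolding continuous_at_eps_delta by blast
    have "\<exists>k\<in>closed_segment (F x) (G x). dist k (switched_field F G y) \<le> e"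
      if "y \<in> ball x (min p q) - {y. y$2 = 0}" for y
    proof (cases "y$2 > 0")
      case True
      then show ?thesis using that p(2)[of y]
        by (intro bexI[of _ "F x"]) (auto simp: switched_field_def dist_commute)
    next
      case False
      then show ?thesis using that q(2)[of y]
        by (intro bexI[of _ "G x"]) (auto simp: switched_field_def dist_commute)
    qed
    moreover have "negligible {y::real^3. y$2 = 0}"
      by (rule negligible_standard_hyperplane_cart)
    ultimately show "\<exists>\<delta>>0. \<exists>N. negligible N \<and> (\<forall>y\<in>ball x \<delta> - N.
        \<exists>k\<in>closed_segment (F x) (G x). dist k (switched_field F G y) \<le> e)"
      using p(1) q(1) by (intro exI[of _ "min p q"] conjI exI[of _ "{y. y$2 = 0}"]) auto
  qed auto
qed

end

theory Submission
  imports Defs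
begin

text \<open>
  In polar coordinates \<open>u = r cos \<theta>\<close>, \<open>v = r sin \<theta>\<close> the angle increases, so it can replace the time,
  and the two switchings happen at the known values \<open>\<theta> = 0\<close> and \<open>\<theta> = \<pi>\<close>. Writing
  \<open>r = \<rho> + \<epsilon> y\<close> and \<open>w = \<epsilon> exp(\<theta>) z\<close>, a periodic orbit is a solution \<open>(\<rho>, y, z)\<close> on \<open>[0, 2\<pi>]\<close>
  with \<open>y(0) = y(2\<pi>) = 0\<close> and \<open>z(0) = exp(2\<pi>) z(2\<pi>)\<close>. At \<open>\<epsilon> = 0\<close> the condition on \<open>y\<close> is an
  affine equation for \<open>\<rho>\<close> with root \<open>\<rho>\<^sub>0\<close>, the radius in the statement, and for small \<open>\<epsilon>\<close> the
  solution is the fixed point of a contraction.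
\<close>

section \<open>Periodic Filippov solutions from loops\<close>

text \<open>At \<epsilon> = 0 every circle around the origin in the plane w = 0 is a periodic orbit,
  so \<epsilon> has to select one of them, and this becomes visible only after a division by
  \<epsilon>. Since r changes at rate \<epsilon>, y is of order one, and
  \<open>\<rho> = r(0)\<close> stays as a separate unknown. The factor exp(\<theta>) is variation of
  constants: it absorbs the term w of the third equation, so at \<epsilon> = 0 neither y nor z
  occurs on the right-hand side. As exp(2\<pi>) differs from 1, a choice of z(0) closes the orbit in
  w, and only y puts a condition on \<rho>. The integral of its equation over one turn is
  \<open>2 * (ap$2 - am$2) + \<rho> * (pi / 2) * S\<close> at \<epsilon> = 0, where S is the sum in
  the hypothesis; the hypothesis makes S nonzero and the root positive. The obstacle is the
  discontinuity. In the angle it sits at a fixed place and does not depend on the unknowns, so the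
  right-hand side is measurable in \<theta> and uniformly Lipschitz in
  \<open>(\<rho>, y, z)\<close>. A contraction therefore yields the whole orbit at once, without
  return maps or crossing times, and with an error linear in \<epsilon>.\<close>

lemma lipschitz_imp_absolutely_continuous_on:
  fixes x :: "real \<Rightarrow> 'a::real_normed_vector"
  assumes "L-lipschitz_on UNIV x"
  shows "absolutely_continuous_on S x"
  unfolding absolutely_continuous_on_def
proof (intro allI impI)
  fix e :: real assume "e > 0"
  have L: "L \<ge> 0" using assms by (rule lipschitz_on_nonneg)
  show "\<exists>d>0. \<forall>D. D division_of \<Union>D \<longrightarrow> \<Union>D \<subseteq> S \<longrightarrow> (\<Sum>k\<in>D. Sup k - Inf k) < d \<longrightarrow>
          (\<Sum>k\<in>D. norm (x (Sup k) - x (Inf k))) < e"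
  \<comment> \<open>\<open>L + 1\<close> instead of \<open>L\<close>, as \<open>L\<close> may be
    0.\<close>
  proof (intro exI[of _ "e / (L + 1)"] conjI allI impI)
    show "e / (L + 1) > 0" using \<open>e > 0\<close> L by simp
    fix D assume D: "D division_of \<Union>D" and small: "(\<Sum>k\<in>D. Sup k - Inf k) < e / (L + 1)"
    have ge: "Sup k - Inf k \<ge> 0" if k: "k \<in> D" for k :: "real set"
    proof -
      obtain a b where "k = cbox a b" "k \<noteq> {}" using division_ofD(3,4)[OF D k] by blast
      then show ?thesis by (simp add: box_real)
    qed
    have "(\<Sum>k\<in>D. norm (x (Sup k) - x (Inf k))) \<le> (\<Sum>k\<in>D. L * (Sup k - Inf k))"
    proof (rule sum_mono)
      fix k assume "k \<in> D"
      then show "norm (x (Sup k) - x (Inf k)) \<le> L * (Sup k - Inf k)"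
        using lipschitz_on_normD[OF assms, of "Sup k" "Inf k"] ge by simp
    qed
    also have "\<dots> \<le> (\<Sum>k\<in>D. (L + 1) * (Sup k - Inf k))"
      by (intro sum_mono mult_right_mono ge) auto
    also have "\<dots> = (\<Sum>k\<in>D. Sup k - Inf k) * (L + 1)"
      by (simp only: sum_distrib_left mult.commute)
    also have "\<dots> < e"
      using small L by (simp add: pos_less_divide_eq)
    finally show "(\<Sum>k\<in>D. norm (x (Sup k) - x (Inf k))) < e" .
  qed
qed

text \<open>Mean value inequality for curves with finitely many corners, which is what a switched
  orbit is. The fundamental theorem of calculus tolerates the finite set \<open>K\<close>.\<close>

lemma lipschitz_on_bounded_vector_derivative:
  fixes x :: "real \<Rightarrow> 'a::banach"
  assumes "finite K" "continuous_on {a..b} x" "C \<ge> 0"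
    and der: "\<And>t. t \<in> {a<..<b} - K \<Longrightarrow>
                \<exists>y. norm y \<le> C \<and> (x has_vector_derivative y) (at t)"
  shows "C-lipschitz_on {a..b} x"
proof (rule lipschitz_on_leI)
  fix s t assume st: "s \<in> {a..b}" "t \<in> {a..b}" "s \<le> t"
  obtain y where y: "\<And>t. t \<in> {a<..<b} - K \<Longrightarrow>
      norm (y t) \<le> C \<and> (x has_vector_derivative y t) (at t)"
    using der by metis
  \<comment> \<open>The default 0 keeps the norm below \<open>C\<close> at the exceptional points
    and at the ends of the interval.\<close>
  let ?y = "\<lambda>r. if r \<in> {a<..<b} - K then y r else 0"
  have "(?y has_integral x t - x s) {s..t}"
    by (rule fundamental_theorem_of_calculus_interior_strong[OF assms(1) st(3)])
       (use st y in \<open>auto intro: continuous_on_subset[OF assms(2)]\<close>)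
  then have "norm (x t - x s) \<le> C * measure lborel (cbox s t)"
    by (intro has_integral_bound[of C ?y]) (use y assms(3) in auto)
  then show "dist (x s) (x t) \<le> C * dist s t"
    using st(3) by (simp add: dist_norm norm_minus_commute)
qed fact

text \<open>Around a time that is not a multiple of \<open>T\<close> the extension is a translate of
  \<open>x\<close> by a fixed number of periods.\<close>

lemma periodic_extension_vector_derivative:
  fixes x :: "real \<Rightarrow> 'a::real_normed_vector"
  assumes "T > 0" and der: "(x has_vector_derivative y) (at (T * frac (t / T)))"
    and nz: "frac (t / T) \<noteq> 0"
  shows "((\<lambda>t. x (T * frac (t / T))) has_vector_derivative y) (at t)"
proof -
  let ?k = "of_int \<lfloor>t / T\<rfloor> * T"
  have eq: "T * frac (s / T) = s - of_int \<lfloor>s / T\<rfloor> * T" for s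
    using \<open>T > 0\<close> by (simp add: frac_def field_simps)
  have "((\<lambda>s. x (s - ?k)) has_vector_derivative y) (at t)"
  proof -
    have "(x has_vector_derivative y) (at (t - ?k))" using der by (simp add: eq)
    then have "(x \<circ> (\<lambda>s. s - ?k) has_vector_derivative 1 *\<^sub>R y) (at t)"
      by (intro vector_diff_chain_at) (auto intro!: derivative_eq_intros)
    then show ?thesis by (simp add: o_def)
  qed
  moreover have "t \<in> {?k <..< ?k + T}"
  proof -
    have "0 < frac (t / T)" "frac (t / T) < 1"
      using nz frac_lt_1[of "t / T"] frac_ge_0[of "t / T"] by linarith+
    then have "0 < T * frac (t / T)" "T * frac (t / T) < T * 1" using \<open>T > 0\<close>
      by (auto intro: mult_strict_left_mono)
    then show ?thesis by (auto simp: eq)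
  qed
  moreover have "x (s - ?k) = x (T * frac (s / T))" if "s \<in> {?k <..< ?k + T}" for s
  proof -
    have "\<lfloor>s / T\<rfloor> = \<lfloor>t / T\<rfloor>"
      using that \<open>T > 0\<close> by (intro floor_unique) (auto simp: field_simps)
    then show ?thesis by (simp add: eq)
  qed
  ultimately show ?thesis
    by (rule has_vector_derivative_transform_within_open[OF _ open_greaterThanLessThan])
qed

lemma periodic_extension_lipschitz_on:
  fixes x :: "real \<Rightarrow> 'a::real_normed_vector"
  assumes "T > 0" and lip: "L-lipschitz_on {0..T} x" and "x 0 = x T"
  shows "L-lipschitz_on UNIV (\<lambda>t. x (T * frac (t / T)))"
proof (rule lipschitz_on_leI)
  fix s t :: real assume "s \<le> t"
  let ?m = "\<lambda>t. of_int \<lfloor>t / T\<rfloor> * T"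
  have eq: "T * frac (s / T) = s - ?m s" for s
    using \<open>T > 0\<close> by (simp add: frac_def field_simps)
  have m: "s - ?m s \<in> {0..T}" for s
  proof -
    have "0 \<le> T * frac (s / T)" "T * frac (s / T) \<le> T * 1"
      using \<open>T > 0\<close> frac_lt_1[of "s / T"] by (auto intro: mult_left_mono simp del: mult_1_right)
    then show ?thesis by (simp add: eq)
  qed
  have fl: "\<lfloor>s / T\<rfloor> \<le> \<lfloor>t / T\<rfloor>" using \<open>T > 0\<close> \<open>s \<le> t\<close> by (intro floor_mono divide_right_mono) auto
  have "norm (x (s - ?m s) - x (t - ?m t)) \<le> L * (t - s)"
  proof (cases "\<lfloor>s / T\<rfloor> = \<lfloor>t / T\<rfloor>")
    case True
    then show ?thesis using lipschitz_on_normD[OF lip m[of s] m[of t]] \<open>s \<le> t\<close> by simp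
  next
    \<comment> \<open>For times in different periods, follow the first one to the end of its period
      and enter the period of the second at its start; \<open>x T = x 0\<close> glues the two
      pieces, and whole periods in between only increase \<open>t - s\<close>.\<close>
    case False
    then have "real_of_int (\<lfloor>s / T\<rfloor> + 1) * T \<le> ?m t"
      using fl \<open>T > 0\<close> by (intro mult_right_mono) linarith+
    then have le: "?m s + T \<le> ?m t" by (simp add: algebra_simps)
    have "norm (x (s - ?m s) - x (t - ?m t))
        \<le> norm (x (s - ?m s) - x T) + norm (x 0 - x (t - ?m t))"
      using norm_triangle_ineq[of "x (s - ?m s) - x T" "x 0 - x (t - ?m t)"] assms(3) by simp
    also have "\<dots> \<le> L * (?m s + T - s) + L * (t - ?m t)"
      using lipschitz_on_normD[OF lip m[of s], of T] lipschitz_on_normD[OF lip _ m[of t], of 0]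
        m[of s] m[of t] \<open>T > 0\<close>
      by (intro add_mono) (auto simp: algebra_simps)
    also have "\<dots> = L * (t - s - (?m t - (?m s + T)))" by (simp add: algebra_simps)
    also have "\<dots> \<le> L * (t - s)"
      using le lipschitz_on_nonneg[OF lip] by (intro mult_left_mono) auto
    finally show ?thesis .
  qed
  then show "dist (x (T * frac (s / T))) (x (T * frac (t / T))) \<le> L * dist s t"
    unfolding eq using \<open>s \<le> t\<close> by (simp add: dist_norm norm_minus_commute)
qed (rule lipschitz_on_nonneg[OF lip])

text \<open>Turns a closed arc into a solution for all times. The differential inclusion can fail
  only at corners, which form a countable set, and the bound \<open>C\<close> on the velocity gives
  a Lipschitz curve, hence absolute continuity.\<close>

lemma periodic_solution_of_loop:
  fixes f :: "'a::euclidean_space \<Rightarrow> 'a" and x :: "real \<Rightarrow> 'a"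
  assumes T: "T > 0" and K: "finite K" and cont: "continuous_on {0..T} x" and closed: "x 0 = x T"
    and C: "C \<ge> 0"
    and der: "\<And>t. t \<in> {0<..<T} - K \<Longrightarrow>
        \<exists>y\<in>filippov_map f (x t). norm y \<le> C \<and> (x has_vector_derivative y) (at t)"
    and nonconst: "s \<in> {0..T}" "x s \<noteq> x 0"
  shows "periodic_solution f (\<lambda>t. x (T * frac (t / T)))"
proof -
  let ?x = "\<lambda>t. x (T * frac (t / T))"
  have "C-lipschitz_on {0..T} x"
    using der by (intro lipschitz_on_bounded_vector_derivative[OF K cont C]) blast
  then have lip: "C-lipschitz_on UNIV ?x"
    by (rule periodic_extension_lipschitz_on[OF T _ closed])
  \<comment> \<open>All translates of the corners by whole periods; 0 is added because the arc may
    close with a corner.\<close>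
  let ?E = "\<Union>n::int. (\<lambda>k. of_int n * T + k) ` insert 0 K"
  have "AE t in lebesgue. \<exists>y\<in>filippov_map f (?x t). (?x has_vector_derivative y) (at t)"
  proof (rule AE_I')
    show "?E \<in> null_sets lebesgue"
      using K by (intro null_sets_completionI countable_imp_null_set_lborel)
        (auto intro: countable_finite)
    show "{t \<in> space lebesgue. \<not> (\<exists>y\<in>filippov_map f (?x t). (?x has_vector_derivative y) (at t))}
        \<subseteq> ?E"
    proof clarify
      fix t assume no: "\<not> (\<exists>y\<in>filippov_map f (?x t). (?x has_vector_derivative y) (at t))"
      show "t \<in> ?E"
      proof (rule ccontr)
        assume "t \<notin> ?E"
        moreover have "t = of_int \<lfloor>t / T\<rfloor> * T + T * frac (t / T)"
          using T by (simp add: frac_def field_simps)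
        ultimately have "T * frac (t / T) \<notin> insert 0 K" by blast
        then have "T * frac (t / T) \<in> {0<..<T} - K" "frac (t / T) \<noteq> 0"
          using T frac_lt_1[of "t / T"] frac_ge_0[of "t / T"] by (auto simp: order_less_le)
        with der[of "T * frac (t / T)"] periodic_extension_vector_derivative[OF T] no
        show False by metis
      qed
    qed
  qed
  then have "filippov_solution f ?x"
    unfolding filippov_solution_def
    using lipschitz_imp_absolutely_continuous_on[OF lip] by blast
  moreover have "?x (t + T) = ?x t" for t
  proof -
    have "(t + T) / T = t / T + 1" using T by (simp add: field_simps)
    then show ?thesis by (simp add: frac_1_eq)
  qed
  moreover have "?x s \<noteq> ?x 0"
  proof -
    have "s \<noteq> T" using nonconst closed by metis
    then have "s / T \<in> {0..<1}" using nonconst(1) T by auto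
    then have "frac (s / T) = s / T" by (simp add: frac_eq)
    then show ?thesis using nonconst T by simp
  qed
  ultimately show ?thesis unfolding periodic_solution_def using T by blast
qed

text \<open>Change of clock from the angle \<open>s\<close> to the time \<open>t\<close>. As
  \<open>h\<close> is the derivative of \<open>t\<close> and stays above \<open>m > 0\<close>,
  \<open>t\<close> has an inverse with derivative \<open>1 / h\<close>, which cancels the factor
  \<open>h\<close> in the velocity of \<open>X\<close>.\<close>

lemma periodic_solution_reparametrized:
  fixes f :: "'a::euclidean_space \<Rightarrow> 'a" and X :: "real \<Rightarrow> 'a"
  assumes \<tau>: "\<tau> > 0" and K: "finite K"
    and X: "continuous_on {0..\<tau>} X" "X 0 = X \<tau>"
    and t: "continuous_on {0..\<tau>} t" "t 0 = 0"
    and m: "m > 0" and C: "C \<ge> 0"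
    and h: "\<And>s. s \<in> {0<..<\<tau>} - K \<Longrightarrow> m \<le> h s \<and> (t has_real_derivative h s) (at s)"
    and der: "\<And>s. s \<in> {0<..<\<tau>} - K \<Longrightarrow> (X has_vector_derivative h s *\<^sub>R y s) (at s)"
    and y: "\<And>s. s \<in> {0<..<\<tau>} - K \<Longrightarrow> y s \<in> filippov_map f (X s) \<and> norm (y s) \<le> C"
    and nonconst: "r \<in> {0..\<tau>}" "X r \<noteq> X 0"
  obtains x where "periodic_solution f x" "x 0 = X 0"
proof -
  have inc: "m * (b - a) \<le> t b - t a" if "0 \<le> a" "a \<le> b" "b \<le> \<tau>" for a b
  proof -
    \<comment> \<open>With the default \<open>m\<close>, the lower bound holds on the whole
      interval, so comparing integrals gives strict growth of \<open>t\<close> across the corners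
      too.\<close>
    let ?h = "\<lambda>s. if s \<in> {0<..<\<tau>} - K then h s else m"
    have I: "(?h has_integral t b - t a) {a..b}"
      by (rule fundamental_theorem_of_calculus_interior_strong[OF K \<open>a \<le> b\<close>])
         (use that h in \<open>auto intro: continuous_on_subset[OF t(1)]
            simp: has_real_derivative_iff_has_vector_derivative[symmetric]\<close>)
    show ?thesis
    proof (rule has_integral_le[OF _ I])
      show "((\<lambda>s. m) has_integral m * (b - a)) {a..b}"
        using has_integral_const_real[of m a b] that by (simp add: mult.commute)
      show "m \<le> ?h s" for s using h[of s] by simp
    qed
  qed
  define T where "T = t \<tau>"
  have T: "T > 0" using less_le_trans[OF mult_pos_pos[OF m \<tau>]] inc[of 0 \<tau>] \<tau> t(2) by (simp add: T_def)
  have less: "t a < t b" if "0 \<le> a" "a < b" "b \<le> \<tau>" for a b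
    using less_le_trans[OF mult_pos_pos[OF m], of "b - a" "t b - t a"] inc[of a b] that by simp
  have less_iff: "t a < t b \<longleftrightarrow> a < b" if "a \<in> {0..\<tau>}" "b \<in> {0..\<tau>}" for a b
    using less[of a b] less[of b a] that by (cases a b rule: linorder_cases) auto
  have inj: "inj_on t {0..\<tau>}"
  proof (rule inj_onI)
    fix a b assume "a \<in> {0..\<tau>}" "b \<in> {0..\<tau>}" "t a = t b"
    then show "a = b" using less[of a b] less[of b a] by (cases a b rule: linorder_cases) auto
  qed
  have img: "t ` {0..\<tau>} = {0..T}"
  proof
    have le: "t a \<le> t b" if "0 \<le> a" "a \<le> b" "b \<le> \<tau>" for a b
      using less[of a b] that by (cases "a = b") auto
    show "t ` {0..\<tau>} \<subseteq> {0..T}"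
      using le[of 0] le[of _ \<tau>] t(2) by (auto simp: T_def)
    show "{0..T} \<subseteq> t ` {0..\<tau>}"
      using IVT'[of t 0 _ \<tau>] t \<tau> by (force simp: T_def)
  qed
  \<comment> \<open>The angle as a function of time; it is continuous because \<open>t\<close> is a
    continuous injection of a compact interval.\<close>
  define g where "g = the_inv_into {0..\<tau>} t"
  have gt: "g (t s) = s" if "s \<in> {0..\<tau>}" for s
    unfolding g_def using inj that by (rule the_inv_into_f_f)
  have tg: "t (g r) = r" and g_in: "g r \<in> {0..\<tau>}" if "r \<in> {0..T}" for r
    using that gt unfolding img[symmetric] by auto
  have g_cont: "continuous_on {0..T} g"
    using continuous_on_inv[OF t(1) compact_Icc] gt img by auto
  have g0: "g 0 = 0" "g T = \<tau>" using gt[of 0] gt[of \<tau>] t(2) \<tau> by (auto simp: T_def)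
  let ?x = "\<lambda>r. X (g r)"
  have "\<exists>v\<in>filippov_map f (?x r). norm v \<le> C \<and> (?x has_vector_derivative v) (at r)"
    if r: "r \<in> {0<..<T} - t ` K" for r
  proof -
    have "t 0 < t (g r)" "t (g r) < t \<tau>" using r tg[of r] t(2) by (auto simp: T_def)
    then have "g r \<in> {0<..<\<tau>}" using less_iff g_in[of r] r \<tau> by auto
    moreover have "g r \<notin> K" using r tg[of r] imageI[of "g r" K t] by auto
    ultimately have gr: "g r \<in> {0<..<\<tau>} - K" by blast
    have "DERIV g r :> inverse (h (g r))"
    proof (rule DERIV_inverse_function)
      show "isCont g r" using r g_cont
        by (auto simp: continuous_on_eq_continuous_at[OF open_greaterThanLessThan, symmetric]
            intro!: continuous_on_interior[of "{0..T}"])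
    qed (use h[OF gr] m r tg in auto)
    then have "(?x has_vector_derivative inverse (h (g r)) *\<^sub>R h (g r) *\<^sub>R y (g r)) (at r)"
      using vector_diff_chain_at[of g _ r, OF _ der[OF gr]]
      by (simp add: has_real_derivative_iff_has_vector_derivative o_def)
    moreover have "h (g r) \<noteq> 0" using h[OF gr] m by auto
    ultimately show ?thesis using y[OF gr] by auto
  qed
  then have "periodic_solution f (\<lambda>r. ?x (T * frac (r / T)))"
  proof (intro periodic_solution_of_loop[where K = "t ` K" and C = C and s = "t r"])
    show "continuous_on {0..T} ?x"
      using g_in by (intro continuous_on_compose2[OF X(1) g_cont]) auto
    show "t r \<in> {0..T}" using nonconst(1) img by blast
    show "?x (t r) \<noteq> ?x 0" using nonconst gt g0 by simp
  qed (use T K C X(2) g0 in auto)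
  then show ?thesis by (rule that) (simp add: g0)
qed

section \<open>Integral equations with piecewise continuous right-hand side\<close>

lemma integral_equation_vector_derivative:
  fixes g :: "real \<Rightarrow> 'a::banach"
  assumes eq: "\<And>s. s \<in> {0..\<tau>} \<Longrightarrow> Y s = c + integral {0..s} g"
    and g: "g integrable_on {0..\<tau>}" and s: "s \<in> {0<..<\<tau>}" and cont: "isCont g s"
  shows "(Y has_vector_derivative g s) (at s)"
proof -
  have "((\<lambda>s. integral {0..s} g) has_vector_derivative g s) (at s within {0..\<tau>})"
    using integral_has_vector_derivative_continuous_at[OF g, of s "{}"] s
      continuous_at_imp_continuous_at_within[OF cont] by auto
  then have "((\<lambda>s. c + integral {0..s} g) has_vector_derivative g s) (at s)"
    using s by (auto simp: at_within_Icc_at intro!: derivative_eq_intros)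
  then show ?thesis
    by (rule has_vector_derivative_transform_within_open[OF _ open_greaterThanLessThan s])
       (use eq in auto)
qed

lemma bounded_measurable_integrable_on:
  fixes f :: "real \<Rightarrow> 'a::euclidean_space"
  assumes "f \<in> borel_measurable borel" "\<And>s. s \<in> {a..b} \<Longrightarrow> norm (f s) \<le> B"
  shows "f integrable_on {a..b}"
proof (rule measurable_bounded_by_integrable_imp_integrable)
  show "f \<in> borel_measurable (lebesgue_on {a..b})"
    using assms(1) by (intro measurable_restrict_space1 measurable_completion) simp
  show "(\<lambda>_. B) integrable_on {a..b}" by (rule integrable_const_ivl)
qed (use assms in auto)

lemma norm_integral_bound:
  fixes f :: "real \<Rightarrow> 'a::euclidean_space"
  assumes "f integrable_on {0..\<tau>}" "s \<in> {0..\<tau>}" "\<And>r. r \<in> {0..\<tau>} \<Longrightarrow> norm (f r) \<le> B"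
  shows "norm (integral {0..s} f) \<le> B * \<tau>"
proof -
  have B: "B \<ge> 0" using assms(2) norm_ge_zero[of "f s"] assms(3)[of s] by linarith
  have "norm (integral (cbox 0 s) f) \<le> B * measure lborel (cbox 0 s)"
    using assms by (intro integrable_bound[OF B])
      (auto intro: integrable_on_subinterval)
  also have "\<dots> \<le> B * \<tau>" using assms(2) B by (auto intro: mult_left_mono)
  finally show ?thesis by simp
qed

section \<open>Perturbed boundary value problems\<close>

text \<open>The bound on \<open>\<Phi>\<close> makes the ball invariant and the Lipschitz bound
  makes the map a contraction. Both are asked for on the ball only, since the nonlinearity of the
  polar equations is not globally Lipschitz.\<close>

lemma small_perturbation_fixed_point:
  fixes X0 :: "'a::{real_normed_vector, complete_space}"
  assumes bound: "\<And>X. X \<in> cball X0 r \<Longrightarrow> norm (\<Phi> X) \<le> C"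
    and lip: "C-lipschitz_on (cball X0 r) \<Phi>"
    and small: "\<bar>\<epsilon>\<bar> * C \<le> r" "\<bar>\<epsilon>\<bar> * C < 1" and r: "r \<ge> 0"
  obtains X where "X \<in> cball X0 r" "X = X0 + \<epsilon> *\<^sub>R \<Phi> X"
proof -
  have "\<exists>!X\<in>cball X0 r. X0 + \<epsilon> *\<^sub>R \<Phi> X = X"
  proof (rule Banach_fix)
    show "complete (cball X0 r)" by (simp add: complete_eq_closed)
    show "cball X0 r \<noteq> {}" using r by simp
    show "0 \<le> \<bar>\<epsilon>\<bar> * C" using lipschitz_on_nonneg[OF lip] by simp
    show "\<bar>\<epsilon>\<bar> * C < 1" by fact
    show "(\<lambda>X. X0 + \<epsilon> *\<^sub>R \<Phi> X) ` cball X0 r \<subseteq> cball X0 r"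
    proof clarsimp
      fix X assume "dist X0 X \<le> r"
      then have "\<bar>\<epsilon>\<bar> * norm (\<Phi> X) \<le> \<bar>\<epsilon>\<bar> * C" by (intro mult_left_mono bound) auto
      then show "dist X0 (X0 + \<epsilon> *\<^sub>R \<Phi> X) \<le> r" using small(1) by (simp add: dist_norm)
    qed
    show "dist (X0 + \<epsilon> *\<^sub>R \<Phi> X) (X0 + \<epsilon> *\<^sub>R \<Phi> Y) \<le> \<bar>\<epsilon>\<bar> * C * dist X Y"
      if "X \<in> cball X0 r" "Y \<in> cball X0 r" for X Y
      using mult_left_mono[OF lipschitz_onD[OF lip, of X Y], of "\<bar>\<epsilon>\<bar>"] that
      by (simp add: dist_norm scaleR_diff_right[symmetric] mult.assoc)
  qed
  then show ?thesis using that by metis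
qed

definition bounded_lipschitz ::
    "'i set \<Rightarrow> 'a::metric_space set \<Rightarrow> ('i \<Rightarrow> 'a \<Rightarrow> 'b::real_normed_vector) \<Rightarrow> bool" where
  "bounded_lipschitz I D f \<longleftrightarrow>
     (\<exists>C. \<forall>i\<in>I. (\<forall>x\<in>D. norm (f i x) \<le> C) \<and> C-lipschitz_on D (f i))"

text \<open>
  With \<open>\<rho>\<close> in place of a constant of integration, the equation
  \<open>Y' = c\<^sub>0 + \<rho> c\<^sub>1 + \<epsilon> N(\<epsilon>, s, \<rho>, Y)\<close> together with the boundary condition \<open>\<phi> (Y \<tau> - Y 0) = 0\<close> is a
  perturbation of size \<open>\<epsilon>\<close> of a problem that has the solution \<open>\<rho>\<^sub>0\<close>, \<open>Y\<^sub>0\<close>: choosing \<open>\<rho>\<close> so that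
  the boundary condition holds and integrating, one gets \<open>(\<rho>, Y) = (\<rho>\<^sub>0, Y\<^sub>0) + \<epsilon> \<Lambda> N(\<rho>, Y)\<close> for
  a bounded linear operator \<open>\<Lambda>\<close>.
\<close>

lemma averaged_boundary_value_problem:
  fixes c0 c1 :: "real \<Rightarrow> 'e::euclidean_space" and N :: "real \<Rightarrow> real \<Rightarrow> real \<times> 'e \<Rightarrow> 'e"
  assumes \<tau>: "\<tau> > 0" and M: "bounded_linear M" and \<phi>: "bounded_linear \<phi>" and \<delta>: "\<delta> > 0"
    and c0: "c0 integrable_on {0..\<tau>}" and c1: "c1 integrable_on {0..\<tau>}"
    and c1_bound: "\<And>s. s \<in> {0..\<tau>} \<Longrightarrow> norm (c1 s) \<le> C1"
    and \<alpha>: "\<phi> (integral {0..\<tau>} c1) = \<alpha>" "\<alpha> \<noteq> (0::real)"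
    and \<rho>0: "\<phi> (integral {0..\<tau>} c0) + \<rho>0 * \<alpha> = 0"
    and meas: "\<And>\<epsilon> \<rho> Y. continuous_on UNIV Y \<Longrightarrow> (\<lambda>s. N \<epsilon> s (\<rho>, Y s)) \<in> borel_measurable borel"
    and N: "\<And>B. \<exists>e>0. bounded_lipschitz ({-e..e} \<times> {0..\<tau>}) (cball \<rho>0 \<delta> \<times> cball 0 B)
                         (\<lambda>(\<epsilon>, s). N \<epsilon> s)"
  obtains \<epsilon>0 B where "\<epsilon>0 > 0" "\<And>\<epsilon>. \<bar>\<epsilon>\<bar> < \<epsilon>0 \<Longrightarrow> \<exists>\<rho> Y. \<bar>\<rho> - \<rho>0\<bar> \<le> \<delta> \<and> \<bar>\<rho> - \<rho>0\<bar> \<le> B * \<bar>\<epsilon>\<bar> \<and>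
      continuous_on UNIV Y \<and> (\<forall>s. norm (Y s) \<le> B) \<and>
      (let G = (\<lambda>s. c0 s + \<rho> *\<^sub>R c1 s + \<epsilon> *\<^sub>R N \<epsilon> s (\<rho>, Y s)) in
         G integrable_on {0..\<tau>} \<and> \<phi> (integral {0..\<tau>} G) = 0 \<and>
         (\<forall>s\<in>{0..\<tau>}. Y s = M (integral {0..\<tau>} G) + integral {0..s} G))"
proof -
  interpret M: bounded_linear M by fact
  interpret \<phi>: bounded_linear \<phi> by fact
  obtain m where m: "m > 0" "\<And>x. norm (M x) \<le> norm x * m" using M.pos_bounded by blast
  obtain l where l: "l > 0" "\<And>x. norm (\<phi> x) \<le> norm x * l" using \<phi>.pos_bounded by blast
  have C1: "C1 \<ge> 0" using order_trans[OF norm_ge_zero c1_bound[of 0]] \<tau> by simp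
  let ?I = "\<lambda>G :: real \<Rightarrow> 'e. G integrable_on {0..\<tau>}"
  \<comment> \<open>The primitive of \<open>G\<close> whose initial value is prescribed by
    \<open>M\<close> in terms of the total integral; this encodes the initial values of y and
    z.\<close>
  define V where "V G s = M (integral {0..\<tau>} G) + integral {0..s} G" for G s
  \<comment> \<open>Clamping the argument to the interval makes \<open>V G\<close> a bounded
    continuous function on the whole line, an element of a Banach space with the supremum
    norm.\<close>
  define W where "W G = Bcontfun (\<lambda>s. V G (max 0 (min \<tau> s)))" for G
  have int_s: "G integrable_on {0..s}" if "?I G" "s \<in> {0..\<tau>}" for G s
    using that by (auto intro: integrable_on_subinterval)
  have cl: "max 0 (min \<tau> s) \<in> {0..\<tau>}" for s using \<tau> by auto
  have V_add: "V (\<lambda>s. a *\<^sub>R G s + b *\<^sub>R H s) s = a *\<^sub>R V G s + b *\<^sub>R V H s"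
    if "?I G" "?I H" "s \<in> {0..\<tau>}" for G H s a b
    using that int_s[OF _ that(3)] int_s[of _ \<tau>] \<tau>
    by (simp add: V_def integral_add integrable_cmul M.add M.scaleR algebra_simps)
  have V_bound: "norm (V G s) \<le> (m + 1) * \<tau> * B"
    if "?I G" "s \<in> {0..\<tau>}" "\<And>s. s \<in> {0..\<tau>} \<Longrightarrow> norm (G s) \<le> B" for G s B
  proof -
    note b = norm_integral_bound[OF that(1) _ that(3)]
    have "norm (V G s) \<le> norm (integral {0..\<tau>} G) * m + norm (integral {0..s} G)"
      unfolding V_def using m(2) by (intro norm_triangle_le add_mono) auto
    also have "\<dots> \<le> (B * \<tau>) * m + B * \<tau>"
      using b[of s] b[of \<tau>] that(2) \<tau> m(1) by (intro add_mono mult_right_mono) auto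
    finally show ?thesis by (simp add: algebra_simps)
  qed
  have W: "apply_bcontfun (W G) s = V G (max 0 (min \<tau> s))" if G: "?I G" for G s
  proof -
    have V: "continuous_on {0..\<tau>} (V G)"
      unfolding V_def by (intro continuous_intros indefinite_integral_continuous_1 G)
    have "continuous_on UNIV (\<lambda>s. V G (max 0 (min \<tau> s)))"
      by (rule continuous_on_compose2[OF V]) (use cl in \<open>auto intro!: continuous_intros\<close>)
    moreover have "bounded (V G ` {0..\<tau>})"
      by (intro compact_imp_bounded compact_continuous_image V) simp
    then have "bounded (range (\<lambda>s. V G (max 0 (min \<tau> s))))"
      by (rule bounded_subset) (use cl in blast)
    ultimately have "(\<lambda>s. V G (max 0 (min \<tau> s))) \<in> bcontfun" by (simp add: bcontfun_def)
    then show ?thesis unfolding W_def by (simp add: Bcontfun_inverse)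
  qed
  have W_add: "W (\<lambda>s. a *\<^sub>R G s + b *\<^sub>R H s) = a *\<^sub>R W G + b *\<^sub>R W H"
    if "?I G" "?I H" for G H a b
    by (rule bcontfun_eqI)
       (simp add: W V_add[OF that cl] that integrable_add integrable_cmul)
  have W_bound: "norm (W G) \<le> (m + 1) * \<tau> * B"
    if "?I G" "\<And>s. s \<in> {0..\<tau>} \<Longrightarrow> norm (G s) \<le> B" for G B
    using V_bound[OF that(1) cl that(2)] by (intro norm_bound) (simp add: W that(1))

  \<comment> \<open>The multiple of \<open>c1\<close> that must be added to \<open>n\<close> for the
    boundary condition: it solves
    \<open>\<kappa> n * \<alpha> + \<phi> (integral {0..\<tau>} n) = 0\<close>.\<close>
  define \<kappa> where "\<kappa> n = - \<phi> (integral {0..\<tau>} n) / \<alpha>" for n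
  define \<Lambda> where "\<Lambda> n = (\<kappa> n, W (\<lambda>s. \<kappa> n *\<^sub>R c1 s + 1 *\<^sub>R n s))" for n
  define q where "q = l * \<tau> / \<bar>\<alpha>\<bar>"
  \<comment> \<open>Operator bound for \<open>\<Lambda>\<close>: \<open>q\<close> bounds
    \<open>\<kappa>\<close>, and \<open>q * C1 + 1\<close> bounds the integrand
    \<open>\<kappa> n *\<^sub>R c1 s + n s\<close> when \<open>n\<close> has size at most 1.\<close>
  define Q where "Q = q + (m + 1) * \<tau> * (q * C1 + 1)"
  have q: "q \<ge> 0" unfolding q_def using l \<tau> by simp
  have Q: "Q \<ge> 0" unfolding Q_def using q m \<tau> C1 by simp
  have \<Lambda>_diff: "\<Lambda> n - \<Lambda> n' = \<Lambda> (\<lambda>s. n s - n' s)" if "?I n" "?I n'" for n n'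
  proof -
    have \<kappa>: "\<kappa> (\<lambda>s. n s - n' s) = \<kappa> n - \<kappa> n'"
      unfolding \<kappa>_def using that by (simp add: integral_diff \<phi>.diff diff_divide_distrib)
    let ?A = "\<lambda>n s. \<kappa> n *\<^sub>R c1 s + 1 *\<^sub>R n s"
    have "?I (?A n)" "?I (?A n')" using that c1 by (auto intro!: integrable_add integrable_cmul)
    from W_add[OF this, of 1 "-1"]
    have "W (?A n) - W (?A n') = W (\<lambda>s. 1 *\<^sub>R ?A n s + (-1) *\<^sub>R ?A n' s)" by simp
    also have "(\<lambda>s. 1 *\<^sub>R ?A n s + (-1) *\<^sub>R ?A n' s) = ?A (\<lambda>s. n s - n' s)"
      by (auto simp: \<kappa> algebra_simps)
    finally show ?thesis by (simp add: \<Lambda>_def \<kappa>)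
  qed
  have \<Lambda>_bound: "norm (\<Lambda> n) \<le> Q * B" if "?I n" and n: "\<And>s. s \<in> {0..\<tau>} \<Longrightarrow> norm (n s) \<le> B" for n B
  proof -
    have B: "B \<ge> 0" using order_trans[OF norm_ge_zero n[of 0]] \<tau> by simp
    have "\<bar>\<phi> (integral {0..\<tau>} n)\<bar> \<le> norm (integral {0..\<tau>} n) * l"
      using l(2) by simp
    also have "\<dots> \<le> (B * \<tau>) * l"
      using norm_integral_bound[OF that(1) _ n, of \<tau>] \<tau> l(1) by (intro mult_right_mono) auto
    finally have \<kappa>: "\<bar>\<kappa> n\<bar> \<le> q * B"
      unfolding \<kappa>_def q_def using divide_right_mono[of _ "(B * \<tau>) * l" "\<bar>\<alpha>\<bar>"]
      by (simp add: mult_ac)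
    have "norm (W (\<lambda>s. \<kappa> n *\<^sub>R c1 s + 1 *\<^sub>R n s)) \<le> (m + 1) * \<tau> * (q * B * C1 + B)"
    proof (rule W_bound)
      show "norm (\<kappa> n *\<^sub>R c1 s + 1 *\<^sub>R n s) \<le> q * B * C1 + B" if "s \<in> {0..\<tau>}" for s
        using that \<kappa> c1_bound[OF that] n[OF that] q B
        by (intro norm_triangle_le add_mono) (auto intro: mult_mono)
    qed (use that(1) c1 in \<open>auto intro!: integrable_add integrable_cmul\<close>)
    moreover have "norm (\<Lambda> n) \<le> \<bar>\<kappa> n\<bar> + norm (W (\<lambda>s. \<kappa> n *\<^sub>R c1 s + 1 *\<^sub>R n s))"
      unfolding \<Lambda>_def norm_Pair real_norm_def by (rule sqrt_sum_squares_le_sum_abs[THEN order_trans]) simp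
    ultimately show ?thesis unfolding Q_def using \<kappa> by (simp add: algebra_simps)
  qed

  define X0 where "X0 = (\<rho>0, W (\<lambda>s. 1 *\<^sub>R c0 s + \<rho>0 *\<^sub>R c1 s))"
  \<comment> \<open>Bounds the function component on the ball of radius \<open>\<delta>\<close>
    around \<open>X0\<close>. It depends only on the unperturbed solution, so \<open>e\<close> and
    \<open>C\<close> may be chosen after it.\<close>
  define B where "B = norm (snd X0) + \<delta>"
  have B: "B \<ge> 0" unfolding B_def using \<delta> by simp
  obtain e where e: "e > 0" and "bounded_lipschitz ({-e..e} \<times> {0..\<tau>}) (cball \<rho>0 \<delta> \<times> cball 0 B)
      (\<lambda>(\<epsilon>, s). N \<epsilon> s)"
    using N by blast
  then obtain C where "\<forall>i\<in>{-e..e} \<times> {0..\<tau>}.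
      (\<forall>x\<in>cball \<rho>0 \<delta> \<times> cball 0 B. norm ((\<lambda>(\<epsilon>, s). N \<epsilon> s) i x) \<le> C) \<and>
      C-lipschitz_on (cball \<rho>0 \<delta> \<times> cball 0 B) ((\<lambda>(\<epsilon>, s). N \<epsilon> s) i)"
    unfolding bounded_lipschitz_def by blast
  from bspec[OF this, of "(_, _)"]
  have C: "(\<forall>x\<in>cball \<rho>0 \<delta> \<times> cball 0 B. norm (N \<epsilon> s x) \<le> C) \<and>
      C-lipschitz_on (cball \<rho>0 \<delta> \<times> cball 0 B) (N \<epsilon> s)"
    if "\<bar>\<epsilon>\<bar> \<le> e" "s \<in> {0..\<tau>}" for \<epsilon> s
    using that by (simp add: abs_le_iff)
  have "C \<ge> 0" using C[of 0 0] e \<tau> lipschitz_on_nonneg by auto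
  define C' where "C' = Q * C"
  have C': "C' \<ge> 0" unfolding C'_def using Q \<open>C \<ge> 0\<close> by simp
  \<comment> \<open>The superposition operator of \<open>N\<close>. It inherits the bound and the
    Lipschitz constant of \<open>N\<close>, because the supremum norm dominates point
    evaluation.\<close>
  define n where "n \<epsilon> X = (\<lambda>s. N \<epsilon> s (fst X, apply_bcontfun (snd X) s))" for \<epsilon> X
  have dom: "(fst X, apply_bcontfun (snd X) s) \<in> cball \<rho>0 \<delta> \<times> cball 0 B"
    if "X \<in> cball X0 \<delta>" for X s
  proof -
    have "dist \<rho>0 (fst X) \<le> \<delta>" "dist (snd X0) (snd X) \<le> \<delta>"
      using that dist_fst_le[of X0 X] dist_snd_le[of X0 X] by (auto simp: X0_def)
    moreover have "norm (apply_bcontfun (snd X) s) \<le> norm (snd X)" by (rule norm_bounded)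
    moreover have "norm (snd X) \<le> norm (snd X0) + dist (snd X0) (snd X)"
      using norm_triangle_ineq[of "snd X0" "snd X - snd X0"]
      by (simp add: dist_norm norm_minus_commute)
    ultimately show ?thesis unfolding B_def by auto
  qed
  have n_bound: "norm (n \<epsilon> X s) \<le> C"
    if "\<bar>\<epsilon>\<bar> \<le> e" "X \<in> cball X0 \<delta>" "s \<in> {0..\<tau>}" for \<epsilon> X s
    using C[of \<epsilon> s] dom[of X s] that by (auto simp: n_def)
  have n_int: "?I (n \<epsilon> X)" if "\<bar>\<epsilon>\<bar> \<le> e" "X \<in> cball X0 \<delta>" for \<epsilon> X
    using n_bound[OF that] meas unfolding n_def
    by (intro bounded_measurable_integrable_on[where B = C]) auto
  have n_lip: "norm (n \<epsilon> X s - n \<epsilon> X' s) \<le> C * dist X X'"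
    if "\<bar>\<epsilon>\<bar> \<le> e" "X \<in> cball X0 \<delta>" "X' \<in> cball X0 \<delta>" "s \<in> {0..\<tau>}" for \<epsilon> X X' s
  proof -
    have "norm (n \<epsilon> X s - n \<epsilon> X' s)
        \<le> C * dist (fst X, apply_bcontfun (snd X) s) (fst X', apply_bcontfun (snd X') s)"
      using lipschitz_onD[OF conjunct2[OF C[of \<epsilon> s]] dom[of X s] dom[of X' s]] that
      by (simp add: n_def dist_norm)
    also have "\<dots> \<le> C * dist X X'"
      using \<open>C \<ge> 0\<close> dist_bounded[of "snd X" s "snd X'"]
      by (intro mult_left_mono) (auto simp: dist_prod_def intro!: power_mono)
    finally show ?thesis .
  qed

  \<comment> \<open>Chosen so that \<open>\<bar>\<epsilon>\<bar> * (C' + 1)\<close> is below both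
    \<open>\<delta>\<close> and 1, the two smallness conditions of the fixed point; the summand 1
    avoids a division by zero.\<close>
  define \<epsilon>0 where "\<epsilon>0 = min e (min \<delta> 1 / (C' + 1))"
  show ?thesis
  proof (rule that[of \<epsilon>0 "max B C'"])
    show "\<epsilon>0 > 0" using e \<delta> C' by (simp add: \<epsilon>0_def)
    fix \<epsilon> assume "\<bar>\<epsilon>\<bar> < \<epsilon>0"
    then have \<epsilon>: "\<bar>\<epsilon>\<bar> \<le> e" and "\<bar>\<epsilon>\<bar> * (C' + 1) < min \<delta> 1"
      using C' by (auto simp: \<epsilon>0_def pos_less_divide_eq)
    then have small: "\<bar>\<epsilon>\<bar> * C' \<le> \<delta>" "\<bar>\<epsilon>\<bar> * C' < 1" by (auto simp: algebra_simps)
    have bound: "norm (\<Lambda> (n \<epsilon> X)) \<le> C'" if "X \<in> cball X0 \<delta>" for X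
      unfolding C'_def using that n_bound[OF \<epsilon>] n_int[OF \<epsilon>] by (intro \<Lambda>_bound) auto
    have lip: "C'-lipschitz_on (cball X0 \<delta>) (\<lambda>X. \<Lambda> (n \<epsilon> X))"
    proof (rule lipschitz_onI)
      fix X X' assume X: "X \<in> cball X0 \<delta>" "X' \<in> cball X0 \<delta>"
      have "norm (\<Lambda> (\<lambda>s. n \<epsilon> X s - n \<epsilon> X' s)) \<le> Q * (C * dist X X')"
        using n_lip[OF \<epsilon> X] n_int[OF \<epsilon>] X by (intro \<Lambda>_bound integrable_diff) auto
      then show "dist (\<Lambda> (n \<epsilon> X)) (\<Lambda> (n \<epsilon> X')) \<le> C' * dist X X'"
        using n_int[OF \<epsilon>] X by (simp add: dist_norm \<Lambda>_diff C'_def mult.assoc)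
    qed (rule C')
    obtain X where X: "X \<in> cball X0 \<delta>" and eq: "X = X0 + \<epsilon> *\<^sub>R \<Lambda> (n \<epsilon> X)"
      by (rule small_perturbation_fixed_point[of X0 \<delta> "\<lambda>X. \<Lambda> (n \<epsilon> X)" C' \<epsilon>])
         (use bound lip small \<delta> in auto)
    define \<rho> where "\<rho> = fst X"
    define Y where "Y = apply_bcontfun (snd X)"
    define G where "G = (\<lambda>s. c0 s + \<rho> *\<^sub>R c1 s + \<epsilon> *\<^sub>R N \<epsilon> s (\<rho>, Y s))"
    have \<rho>: "\<rho> = \<rho>0 + \<epsilon> * \<kappa> (n \<epsilon> X)" unfolding \<rho>_def by (subst eq) (simp add: X0_def \<Lambda>_def)
    have n_eq: "n \<epsilon> X = (\<lambda>s. N \<epsilon> s (\<rho>, Y s))" by (simp add: n_def \<rho>_def Y_def)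
    note int = n_int[OF \<epsilon> X] c0 c1
    have int_G: "?I G" unfolding G_def n_eq[symmetric, THEN fun_cong]
      by (intro integrable_add integrable_cmul int)
    have "integral {0..\<tau>} G
        = integral {0..\<tau>} c0 + \<rho> *\<^sub>R integral {0..\<tau>} c1 + \<epsilon> *\<^sub>R integral {0..\<tau>} (n \<epsilon> X)"
      unfolding G_def n_eq[symmetric, THEN fun_cong]
      by (simp add: integral_add integrable_add integrable_cmul int)
    \<comment> \<open>The terms free of \<epsilon> cancel by the equation for
      \<open>\<rho>0\<close>, the terms with factor \<epsilon> by the choice of
      \<open>\<kappa>\<close>.\<close>
    then have "\<phi> (integral {0..\<tau>} G) = 0"
      using \<rho>0 \<alpha> by (simp add: \<phi>.add \<phi>.scaleR \<rho> \<kappa>_def field_simps)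
    moreover have "snd X = W G"
    proof -
      define k where "k = \<kappa> (n \<epsilon> X)"
      let ?A = "\<lambda>s. 1 *\<^sub>R c0 s + \<rho>0 *\<^sub>R c1 s" and ?B = "\<lambda>s. k *\<^sub>R c1 s + 1 *\<^sub>R n \<epsilon> X s"
      have "?I ?A" "?I ?B" by (auto intro!: integrable_add integrable_cmul int)
      have "snd X = 1 *\<^sub>R W ?A + \<epsilon> *\<^sub>R W ?B"
        unfolding k_def by (subst eq) (simp add: X0_def \<Lambda>_def)
      also have "\<dots> = W (\<lambda>s. 1 *\<^sub>R ?A s + \<epsilon> *\<^sub>R ?B s)"
        by (rule W_add[symmetric]) fact+
      also have "(\<lambda>s. 1 *\<^sub>R ?A s + \<epsilon> *\<^sub>R ?B s) = G"
        by (auto simp: G_def n_eq \<rho>[folded k_def] algebra_simps)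
      finally show ?thesis .
    qed
    then have "Y s = M (integral {0..\<tau>} G) + integral {0..s} G" if "s \<in> {0..\<tau>}" for s
      using that by (simp add: Y_def W[OF int_G] V_def)
    moreover have "\<bar>\<rho> - \<rho>0\<bar> \<le> \<delta>" "norm (Y s) \<le> B" for s
      using dom[OF X, of s] by (auto simp: \<rho>_def Y_def dist_real_def)
    moreover have "\<bar>\<rho> - \<rho>0\<bar> \<le> C' * \<bar>\<epsilon>\<bar>"
    proof -
      have "\<bar>\<kappa> (n \<epsilon> X)\<bar> \<le> C'"
        using bound[OF X] norm_fst_le[of "\<kappa> (n \<epsilon> X)" "snd (\<Lambda> (n \<epsilon> X))"]
        by (simp add: \<Lambda>_def)
      then have "\<bar>\<epsilon>\<bar> * \<bar>\<kappa> (n \<epsilon> X)\<bar> \<le> \<bar>\<epsilon>\<bar> * C'" by (intro mult_left_mono) auto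
      then show ?thesis by (simp add: \<rho> abs_mult mult.commute)
    qed
    moreover have "C' * \<bar>\<epsilon>\<bar> \<le> max B C' * \<bar>\<epsilon>\<bar>" by (intro mult_right_mono) auto
    moreover have "continuous_on UNIV Y" by (simp add: Y_def)
    ultimately show "\<exists>\<rho> Y. \<bar>\<rho> - \<rho>0\<bar> \<le> \<delta> \<and> \<bar>\<rho> - \<rho>0\<bar> \<le> max B C' * \<bar>\<epsilon>\<bar> \<and>
      continuous_on UNIV Y \<and> (\<forall>s. norm (Y s) \<le> max B C') \<and>
      (let G = (\<lambda>s. c0 s + \<rho> *\<^sub>R c1 s + \<epsilon> *\<^sub>R N \<epsilon> s (\<rho>, Y s)) in
         G integrable_on {0..\<tau>} \<and> \<phi> (integral {0..\<tau>} G) = 0 \<and>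
         (\<forall>s\<in>{0..\<tau>}. Y s = M (integral {0..\<tau>} G) + integral {0..s} G))"
      using int_G unfolding G_def Let_def
      by (intro exI[of _ \<rho>] exI[of _ Y]) (auto intro: order_trans max.coboundedI1)
  qed
qed

section \<open>Bounded Lipschitz families\<close>

lemma bounded_lipschitzI:
  assumes "\<And>i x. i \<in> I \<Longrightarrow> x \<in> D \<Longrightarrow> norm (f i x) \<le> C"
    and "\<And>i x y. i \<in> I \<Longrightarrow> x \<in> D \<Longrightarrow> y \<in> D \<Longrightarrow> norm (f i x - f i y) \<le> L * dist x y"
  shows "bounded_lipschitz I D f"
  unfolding bounded_lipschitz_def
proof (intro exI[of _ "max (max C L) 0"] ballI conjI)
  fix i assume i: "i \<in> I"
  show "norm (f i x) \<le> max (max C L) 0" if "x \<in> D" for x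
    using assms(1)[OF i that] by simp
  show "(max (max C L) 0)-lipschitz_on D (f i)"
  proof (rule lipschitz_onI)
    fix x y assume "x \<in> D" "y \<in> D"
    then have "dist (f i x) (f i y) \<le> L * dist x y" using assms(2)[OF i] by (simp add: dist_norm)
    also have "\<dots> \<le> max (max C L) 0 * dist x y" by (intro mult_right_mono) auto
    finally show "dist (f i x) (f i y) \<le> max (max C L) 0 * dist x y" .
  qed simp
qed

lemma bounded_lipschitzE:
  assumes "bounded_lipschitz I D f"
  obtains C where "C \<ge> 0" "\<And>i x. i \<in> I \<Longrightarrow> x \<in> D \<Longrightarrow> norm (f i x) \<le> C"
    "\<And>i x y. i \<in> I \<Longrightarrow> x \<in> D \<Longrightarrow> y \<in> D \<Longrightarrow> norm (f i x - f i y) \<le> C * dist x y"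
proof -
  obtain C where C: "\<forall>i\<in>I. (\<forall>x\<in>D. norm (f i x) \<le> C) \<and> C-lipschitz_on D (f i)"
    using assms unfolding bounded_lipschitz_def by blast
  show ?thesis
  proof (rule that[of "max C 0"])
    fix i x y assume i: "i \<in> I" "x \<in> D" "y \<in> D"
    then have "norm (f i x - f i y) \<le> C * dist x y"
      using C lipschitz_onD[of C D "f i" x y] by (simp add: dist_norm)
    also have "\<dots> \<le> max C 0 * dist x y" by (intro mult_right_mono) auto
    finally show "norm (f i x - f i y) \<le> max C 0 * dist x y" .
  qed (use C in \<open>auto intro: le_max_iff_disj[THEN iffD2]\<close>)
qed

text \<open>Covers all factors that depend on \<epsilon> and the angle alone. Boundedness is enough
  for them, which is how the discontinuous coefficients enter.\<close>

lemma bounded_lipschitz_const: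
  assumes "bounded (c ` I)"
  shows "bounded_lipschitz I D (\<lambda>i x. c i)"
proof -
  obtain C where "\<And>i. i \<in> I \<Longrightarrow> norm (c i) \<le> C" using assms by (auto simp: bounded_iff)
  then show ?thesis by (intro bounded_lipschitzI[where C = C and L = 0]) auto
qed

lemma bounded_lipschitz_ident:
  fixes f :: "'a::metric_space \<Rightarrow> 'b::real_normed_vector"
  assumes "\<And>x y. dist (f x) (f y) \<le> dist x y" "bounded D"
  shows "bounded_lipschitz I D (\<lambda>i. f)"
proof -
  have "bounded (f ` D)"
    using assms(2) order_trans[OF assms(1)] unfolding bounded_def by blast
  then obtain C where "\<And>x. x \<in> D \<Longrightarrow> norm (f x) \<le> C" by (auto simp: bounded_iff)
  then show ?thesis
    using assms(1) by (intro bounded_lipschitzI[where C = C and L = 1]) (auto simp: dist_norm)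
qed

lemma bounded_lipschitz_add:
  assumes "bounded_lipschitz I D f" "bounded_lipschitz I D g"
  shows "bounded_lipschitz I D (\<lambda>i x. f i x + g i x)"
proof -
  obtain A where "A \<ge> 0" and A: "\<And>i x. i \<in> I \<Longrightarrow> x \<in> D \<Longrightarrow> norm (f i x) \<le> A"
    "\<And>i x y. i \<in> I \<Longrightarrow> x \<in> D \<Longrightarrow> y \<in> D \<Longrightarrow> norm (f i x - f i y) \<le> A * dist x y"
    by (rule bounded_lipschitzE[OF assms(1)]) (rule that)
  obtain B where "B \<ge> 0" and B: "\<And>i x. i \<in> I \<Longrightarrow> x \<in> D \<Longrightarrow> norm (g i x) \<le> B"
    "\<And>i x y. i \<in> I \<Longrightarrow> x \<in> D \<Longrightarrow> y \<in> D \<Longrightarrow> norm (g i x - g i y) \<le> B * dist x y"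
    by (rule bounded_lipschitzE[OF assms(2)]) (rule that)
  show ?thesis
  proof (rule bounded_lipschitzI[where C = "A + B" and L = "A + B"])
    fix i x y assume i: "i \<in> I" "x \<in> D" "y \<in> D"
    show "norm (f i x + g i x) \<le> A + B"
      using A(1)[of i x] B(1)[of i x] i by (intro norm_triangle_le add_mono) auto
    have "norm ((f i x - f i y) + (g i x - g i y)) \<le> A * dist x y + B * dist x y"
      using A(2)[of i x y] B(2)[of i x y] i by (intro norm_triangle_le add_mono) auto
    then show "norm (f i x + g i x - (f i y + g i y)) \<le> (A + B) * dist x y"
      by (simp add: algebra_simps)
  qed
qed

lemma bounded_lipschitz_mult:
  fixes f g :: "'i \<Rightarrow> 'a::metric_space \<Rightarrow> real"
  assumes "bounded_lipschitz I D f" "bounded_lipschitz I D g"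
  shows "bounded_lipschitz I D (\<lambda>i x. f i x * g i x)"
proof -
  obtain A where A: "A \<ge> 0" "\<And>i x. i \<in> I \<Longrightarrow> x \<in> D \<Longrightarrow> norm (f i x) \<le> A"
    "\<And>i x y. i \<in> I \<Longrightarrow> x \<in> D \<Longrightarrow> y \<in> D \<Longrightarrow> norm (f i x - f i y) \<le> A * dist x y"
    by (rule bounded_lipschitzE[OF assms(1)]) (rule that)
  obtain B where B: "B \<ge> 0" "\<And>i x. i \<in> I \<Longrightarrow> x \<in> D \<Longrightarrow> norm (g i x) \<le> B"
    "\<And>i x y. i \<in> I \<Longrightarrow> x \<in> D \<Longrightarrow> y \<in> D \<Longrightarrow> norm (g i x - g i y) \<le> B * dist x y"
    by (rule bounded_lipschitzE[OF assms(2)]) (rule that)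
  show ?thesis
  proof (rule bounded_lipschitzI[where C = "A * B" and L = "A * B + A * B"])
    fix i x y assume i: "i \<in> I" "x \<in> D" "y \<in> D"
    show "norm (f i x * g i x) \<le> A * B"
      unfolding norm_mult using A B i by (intro mult_mono) auto
    have "norm (f i x * (g i x - g i y) + (f i x - f i y) * g i y)
        \<le> A * (B * dist x y) + (A * dist x y) * B"
      using A B i by (intro norm_triangle_le add_mono) (auto simp: norm_mult abs_mult intro!: mult_mono)
    then show "norm (f i x * g i x - f i y * g i y) \<le> (A * B + A * B) * dist x y"
      by (simp add: algebra_simps)
  qed
qed

lemma bounded_lipschitz_diff:
  fixes f g :: "'i \<Rightarrow> 'a::metric_space \<Rightarrow> real"
  assumes "bounded_lipschitz I D f" "bounded_lipschitz I D g"
  shows "bounded_lipschitz I D (\<lambda>i x. f i x - g i x)"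
proof -
  have "bounded_lipschitz I D (\<lambda>i x. - 1 :: real)" by (rule bounded_lipschitz_const) (auto simp: bounded_iff)
  from bounded_lipschitz_add[OF assms(1) bounded_lipschitz_mult[OF this assms(2)]]
  show ?thesis by simp
qed

lemma bounded_lipschitz_inverse:
  fixes f :: "'i \<Rightarrow> 'a::metric_space \<Rightarrow> real"
  assumes "bounded_lipschitz I D f" and c: "c > 0" "\<And>i x. i \<in> I \<Longrightarrow> x \<in> D \<Longrightarrow> c \<le> f i x"
  shows "bounded_lipschitz I D (\<lambda>i x. inverse (f i x))"
proof -
  obtain A where A: "A \<ge> 0" "\<And>i x. i \<in> I \<Longrightarrow> x \<in> D \<Longrightarrow> norm (f i x) \<le> A"
    "\<And>i x y. i \<in> I \<Longrightarrow> x \<in> D \<Longrightarrow> y \<in> D \<Longrightarrow> norm (f i x - f i y) \<le> A * dist x y"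
    by (rule bounded_lipschitzE[OF assms(1)]) (rule that)
  show ?thesis
  proof (rule bounded_lipschitzI[where C = "inverse c" and L = "inverse c * A * inverse c"])
    fix i x y assume i: "i \<in> I" "x \<in> D" "y \<in> D"
    have pos: "f i x > 0" "f i y > 0" using c i by (meson less_le_trans)+
    have inv: "inverse (f i x) \<le> inverse c" "inverse (f i y) \<le> inverse c"
      using c i by (auto intro: le_imp_inverse_le)
    then show "norm (inverse (f i x)) \<le> inverse c" using pos by simp
    have "inverse (f i x) - inverse (f i y) = inverse (f i x) * (f i y - f i x) * inverse (f i y)"
      using pos by (simp add: field_simps)
    also have "norm \<dots> \<le> inverse c * (A * dist x y) * inverse c"
      unfolding norm_mult using pos inv A(3)[of i x y] i A(1) c(1)
      by (intro mult_mono) (auto simp: abs_minus_commute)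
    finally show "norm (inverse (f i x) - inverse (f i y)) \<le> inverse c * A * inverse c * dist x y"
      by (simp add: mult_ac)
  qed
qed

lemma bounded_lipschitz_Pair:
  assumes "bounded_lipschitz I D f" "bounded_lipschitz I D g"
  shows "bounded_lipschitz I D (\<lambda>i x. (f i x, g i x))"
proof -
  obtain A where "A \<ge> 0" and A: "\<And>i x. i \<in> I \<Longrightarrow> x \<in> D \<Longrightarrow> norm (f i x) \<le> A"
    "\<And>i x y. i \<in> I \<Longrightarrow> x \<in> D \<Longrightarrow> y \<in> D \<Longrightarrow> norm (f i x - f i y) \<le> A * dist x y"
    by (rule bounded_lipschitzE[OF assms(1)]) (rule that)
  obtain B where "B \<ge> 0" and B: "\<And>i x. i \<in> I \<Longrightarrow> x \<in> D \<Longrightarrow> norm (g i x) \<le> B"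
    "\<And>i x y. i \<in> I \<Longrightarrow> x \<in> D \<Longrightarrow> y \<in> D \<Longrightarrow> norm (g i x - g i y) \<le> B * dist x y"
    by (rule bounded_lipschitzE[OF assms(2)]) (rule that)
  show ?thesis
  proof (rule bounded_lipschitzI[where C = "A + B" and L = "A + B"])
    fix i x y assume i: "i \<in> I" "x \<in> D" "y \<in> D"
    show "norm (f i x, g i x) \<le> A + B"
      using A(1)[of i x] B(1)[of i x] i norm_Pair_le[of "f i x" "g i x"] by auto
    have "norm (f i x - f i y, g i x - g i y) \<le> A * dist x y + B * dist x y"
      using A(2)[of i x y] B(2)[of i x y] i norm_Pair_le[of "f i x - f i y" "g i x - g i y"] by auto
    then show "norm ((f i x, g i x) - (f i y, g i y)) \<le> (A + B) * dist x y"
      by (simp add: algebra_simps)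
  qed
qed

section \<open>Coefficients that switch at the angle \<pi>\<close>

text \<open>Since v = r sin s with r > 0, the angle alone decides on which side of the plane v = 0 a
  point of the first or second half-turn lies.\<close>

definition half :: "'a \<Rightarrow> 'a \<Rightarrow> real \<Rightarrow> 'a" where
  "half p q s = (if s \<le> pi then p else q)"

lemma borel_measurable_half [measurable]:
  "(\<lambda>s. half p q s) \<in> borel_measurable (borel :: real measure)" for p q :: real
  unfolding half_def by measurable

lemma isCont_half: "s \<noteq> pi \<Longrightarrow> isCont (\<lambda>s. half p q s) s" for p q :: real
proof -
  assume "s \<noteq> pi"
  then consider "s < pi" | "s > pi" by linarith
  then show ?thesis
  proof cases
    case 1
    then have "\<forall>\<^sub>F s in nhds s. half p q s = p"
      by (intro eventually_mono[OF eventually_nhds_in_open[of "{..<pi}" s]]) (auto simp: half_def)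
    then show ?thesis by (subst isCont_cong) auto
  next
    case 2
    then have "\<forall>\<^sub>F s in nhds s. half p q s = q"
      by (intro eventually_mono[OF eventually_nhds_in_open[of "{pi<..}" s]]) (auto simp: half_def)
    then show ?thesis by (subst isCont_cong) auto
  qed
qed

lemma has_integral_half:
  fixes f g :: "real \<Rightarrow> real"
  assumes "(f has_integral A) {0..pi}" "(g has_integral B) {pi..2 * pi}"
  shows "((\<lambda>s. half (f s) (g s) s) has_integral A + B) {0..2 * pi}"
proof (rule has_integral_combine)
  show "((\<lambda>s. half (f s) (g s) s) has_integral A) {0..pi}"
    using assms(1) by (rule has_integral_eq[rotated]) (simp add: half_def)
  \<comment> \<open>At \<open>pi\<close> itself \<open>half\<close> still takes its first value, so
    the integrand is changed at one point.\<close>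
  show "((\<lambda>s. half (f s) (g s) s) has_integral B) {pi..2 * pi}"
    using assms(2) by (rule has_integral_spike_finite[of "{pi}", rotated 2]) (auto simp: half_def)
qed auto

lemma bounded_half: "bounded ((\<lambda>i. half p q (f i)) ` I)" for p q :: real
  by (rule bounded_subset[of "{p, q}"]) (auto simp: half_def)

section \<open>The piecewise linear system in polar coordinates\<close>

text \<open>Puts vectors in a form to which the rules for continuity and derivatives of sums
  apply.\<close>

lemma vector_3_eq: "vector [a, b, c] = a *\<^sub>R axis 1 1 + b *\<^sub>R axis 2 1 + c *\<^sub>R (axis 3 1 :: real^3)"
  by (simp add: vec_eq_iff forall_3 axis_def)

lemma continuous_on_linear_field: "continuous_on S (linear_field \<epsilon> a b c d)"
  unfolding linear_field_def Let_def vector_3_eq by (intro continuous_intros)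

lemma isCont_linear_field: "isCont (linear_field \<epsilon> a b c d) x"
  using continuous_on_linear_field[of UNIV] by (simp add: continuous_on_eq_continuous_at)

context
  fixes ap bp cp dp am bm cm dm :: "real^3"
begin

text \<open>
  The argument \<open>p\<close> below is \<open>(\<rho>, y, z)\<close>, so that \<open>rad\<close> is \<open>r\<close>, \<open>height\<close> is \<open>w\<close>, and \<open>pert i\<close> is the
  factor of \<open>\<epsilon>\<close> in the \<open>i\<close>-th equation at the angle \<open>s\<close>.
\<close>

definition rad :: "real \<Rightarrow> real \<times> real \<times> real \<Rightarrow> real" where
  "rad \<epsilon> p = fst p + \<epsilon> * fst (snd p)"

definition height :: "real \<Rightarrow> real \<Rightarrow> real \<times> real \<times> real \<Rightarrow> real" where
  "height \<epsilon> s p = \<epsilon> * (exp s * snd (snd p))"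

definition pert :: "3 \<Rightarrow> real \<Rightarrow> real \<Rightarrow> real \<times> real \<times> real \<Rightarrow> real" where
  "pert i \<epsilon> s p = half (ap$i) (am$i) s + half (bp$i) (bm$i) s * (rad \<epsilon> p * cos s)
     + half (cp$i) (cm$i) s * (rad \<epsilon> p * sin s) + half (dp$i) (dm$i) s * height \<epsilon> s p"

text \<open>Along the flow, r has time derivative \<open>\<epsilon> * radial\<close>: the
  unperturbed rotation contributes nothing to it.\<close>

definition radial :: "real \<Rightarrow> real \<Rightarrow> real \<times> real \<times> real \<Rightarrow> real" where
  "radial \<epsilon> s p = cos s * pert 1 \<epsilon> s p + sin s * pert 2 \<epsilon> s p"

definition angular :: "real \<Rightarrow> real \<Rightarrow> real \<times> real \<times> real \<Rightarrow> real" where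
  "angular \<epsilon> s p = cos s * pert 2 \<epsilon> s p - sin s * pert 1 \<epsilon> s p"

text \<open>The radius times the angular velocity, that is (u v' - v u') / r with time
  derivatives.\<close>

definition den :: "real \<Rightarrow> real \<Rightarrow> real \<times> real \<times> real \<Rightarrow> real" where
  "den \<epsilon> s p = rad \<epsilon> p + \<epsilon> * angular \<epsilon> s p"

definition slope :: "3 \<Rightarrow> real \<Rightarrow> real" where
  "slope i s = half (bp$i) (bm$i) s * cos s + half (cp$i) (cm$i) s * sin s"

text \<open>At \<epsilon> = 0 the derivative of (y, z) with respect to the angle is affine in
  \<rho>, namely \<open>c0 s + \<rho> *\<^sub>R c1 s\<close>. The factor \<open>exp (- s)\<close>
  comes from the substitution for w.\<close>

definition c0 :: "real \<Rightarrow> real \<times> real" where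
  "c0 s = (cos s * half (ap$1) (am$1) s + sin s * half (ap$2) (am$2) s,
           exp (- s) * half (ap$3) (am$3) s)"

definition c1 :: "real \<Rightarrow> real \<times> real" where
  "c1 s = (cos s * slope 1 s + sin s * slope 2 s, exp (- s) * slope 3 s)"

text \<open>An exact quotient and not a Taylor estimate:
  \<open>rad / den = 1 - \<epsilon> * angular / den\<close> splits off a factor \<epsilon>
  explicitly, so the formula also makes sense at \<epsilon> = 0. The other terms come from the parts
  of \<open>rad\<close> and \<open>height\<close> that carry the factor \<epsilon>.\<close>

definition remainder :: "real \<Rightarrow> real \<Rightarrow> real \<times> real \<times> real \<Rightarrow> real \<times> real" where
  "remainder \<epsilon> s p =
     ((cos s * slope 1 s + sin s * slope 2 s) * fst (snd p)
        + (cos s * half (dp$1) (dm$1) s + sin s * half (dp$2) (dm$2) s) * (exp s * snd (snd p))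
        - radial \<epsilon> s p * angular \<epsilon> s p * inverse (den \<epsilon> s p),
      exp (- s) * (slope 3 s * fst (snd p) + half (dp$3) (dm$3) s * (exp s * snd (snd p))
        - (exp s * snd (snd p) + pert 3 \<epsilon> s p) * angular \<epsilon> s p * inverse (den \<epsilon> s p)))"

text \<open>The right-hand side is what the chain rule gives for the derivatives of y and z with
  respect to the angle; in the second component the term w has cancelled against the derivative of
  exp(\<theta>).\<close>

lemma polar_field_eq:
  assumes "den \<epsilon> s (\<rho>, Y) \<noteq> 0"
  shows "c0 s + \<rho> *\<^sub>R c1 s + \<epsilon> *\<^sub>R remainder \<epsilon> s (\<rho>, Y) =
    (radial \<epsilon> s (\<rho>, Y) * (rad \<epsilon> (\<rho>, Y) / den \<epsilon> s (\<rho>, Y)),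
     exp (- s) * (pert 3 \<epsilon> s (\<rho>, Y) * rad \<epsilon> (\<rho>, Y) - height \<epsilon> s (\<rho>, Y) * angular \<epsilon> s (\<rho>, Y))
       / den \<epsilon> s (\<rho>, Y))"
proof -
  define q where "q = angular \<epsilon> s (\<rho>, Y)"
  define D where "D = den \<epsilon> s (\<rho>, Y)"
  define R where "R = rad \<epsilon> (\<rho>, Y)"
  define P where "P = radial \<epsilon> s (\<rho>, Y)"
  define F where "F = pert 3 \<epsilon> s (\<rho>, Y)"
  have D: "D = R + \<epsilon> * q" "D \<noteq> 0"
    using assms by (simp_all add: D_def R_def q_def den_def)
  have "P = fst (c0 s) + \<rho> * fst (c1 s) + \<epsilon> * ((cos s * slope 1 s + sin s * slope 2 s) * fst Y
        + (cos s * half (dp$1) (dm$1) s + sin s * half (dp$2) (dm$2) s) * (exp s * snd Y))"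
    by (simp add: P_def radial_def pert_def rad_def height_def c0_def c1_def slope_def algebra_simps)
  then have "fst (c0 s + \<rho> *\<^sub>R c1 s + \<epsilon> *\<^sub>R remainder \<epsilon> s (\<rho>, Y)) = P - \<epsilon> * (P * q * inverse D)"
    by (simp add: remainder_def P_def[symmetric] q_def[symmetric] D_def[symmetric] algebra_simps)
  also have "\<dots> = P * (R / D)" using D by (simp add: field_simps)
  finally have 1: "fst (c0 s + \<rho> *\<^sub>R c1 s + \<epsilon> *\<^sub>R remainder \<epsilon> s (\<rho>, Y)) = P * (R / D)" .
  have "exp (- s) * F = snd (c0 s) + \<rho> * snd (c1 s)
      + \<epsilon> * (exp (- s) * (slope 3 s * fst Y + half (dp$3) (dm$3) s * (exp s * snd Y)))"
    by (simp add: F_def pert_def rad_def height_def c0_def c1_def slope_def algebra_simps)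
  then have "snd (c0 s + \<rho> *\<^sub>R c1 s + \<epsilon> *\<^sub>R remainder \<epsilon> s (\<rho>, Y))
      = exp (- s) * (F - \<epsilon> * ((exp s * snd Y + F) * q * inverse D))"
    by (simp add: remainder_def F_def[symmetric] q_def[symmetric] D_def[symmetric] algebra_simps)
  also have "F - \<epsilon> * ((exp s * snd Y + F) * q * inverse D) = (F * R - height \<epsilon> s (\<rho>, Y) * q) / D"
    using D by (simp add: height_def field_simps)
  finally have 2: "snd (c0 s + \<rho> *\<^sub>R c1 s + \<epsilon> *\<^sub>R remainder \<epsilon> s (\<rho>, Y))
      = exp (- s) * (F * R - height \<epsilon> s (\<rho>, Y) * q) / D" by simp
  show ?thesis
    using 1 2 unfolding P_def R_def D_def F_def q_def by (intro prod_eqI) (simp_all only: fst_conv snd_conv)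
qed

lemma borel_measurable_remainder:
  assumes "continuous_on UNIV Y"
  shows "(\<lambda>s. remainder \<epsilon> s (\<rho>, Y s)) \<in> borel_measurable borel"
proof -
  have [measurable]: "Y \<in> borel_measurable borel"
    using assms by (rule borel_measurable_continuous_onI)
  have [measurable]: "(\<lambda>s. fst (Y s)) \<in> borel_measurable borel" "(\<lambda>s. snd (Y s)) \<in> borel_measurable borel"
    using assms by (auto intro!: borel_measurable_continuous_onI continuous_intros)
  show ?thesis
    unfolding remainder_def den_def radial_def angular_def pert_def rad_def height_def slope_def
      fst_conv snd_conv
    by (intro borel_measurable_Pair) measurable
qed

section \<open>Uniform Lipschitz bounds for the polar equations\<close>

abbreviation index :: "real \<Rightarrow> (real \<times> real) set" where
  "index e \<equiv> {-e..e} \<times> {0..2 * pi}"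

lemma bounded_lipschitz_coefficients:
  "bounded_lipschitz (index e) D (\<lambda>i x. fst i)"
  "bounded_lipschitz (index e) D (\<lambda>i x. cos (snd i))"
  "bounded_lipschitz (index e) D (\<lambda>i x. sin (snd i))"
  "bounded_lipschitz (index e) D (\<lambda>i x. exp (snd i))"
  "bounded_lipschitz (index e) D (\<lambda>i x. exp (- snd i))"
  "bounded_lipschitz (index e) D (\<lambda>i x. half p q (snd i))" for p q :: real
proof -
  have *: "bounded_lipschitz (index e) D (\<lambda>i x. g i)" if "continuous_on (index e) g"
    for g :: "real \<times> real \<Rightarrow> real"
    by (intro bounded_lipschitz_const compact_imp_bounded compact_continuous_image that
        compact_Times compact_Icc)
  show
    "bounded_lipschitz (index e) D (\<lambda>i x. fst i)"
    "bounded_lipschitz (index e) D (\<lambda>i x. cos (snd i))"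
    "bounded_lipschitz (index e) D (\<lambda>i x. sin (snd i))"
    "bounded_lipschitz (index e) D (\<lambda>i x. exp (snd i))"
    "bounded_lipschitz (index e) D (\<lambda>i x. exp (- snd i))"
    by (rule *, intro continuous_intros)+
  show "bounded_lipschitz (index e) D (\<lambda>i x. half p q (snd i))"
    by (intro bounded_lipschitz_const bounded_half)
qed

context
  fixes \<rho>0 :: real
  assumes \<rho>0: "\<rho>0 > 0"
begin

text \<open>The radius \<open>\<rho>0 / 2\<close> keeps \<rho> away from 0, where polar coordinates
  degenerate.\<close>

abbreviation dom :: "real \<Rightarrow> (real \<times> real \<times> real) set" where
  "dom B \<equiv> cball \<rho>0 (\<rho>0 / 2) \<times> cball 0 B"

lemma bounded_lipschitz_variables:
  "bounded_lipschitz I (dom B) (\<lambda>i. fst)"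
  "bounded_lipschitz I (dom B) (\<lambda>i x. fst (snd x))"
  "bounded_lipschitz I (dom B) (\<lambda>i x. snd (snd x))"
proof -
  have "bounded (dom B)" by (intro bounded_Times bounded_cball)
  moreover have "dist (fst (snd x)) (fst (snd y)) \<le> dist x y"
    "dist (snd (snd x)) (snd (snd y)) \<le> dist x y" for x y :: "real \<times> real \<times> real"
    by (meson order_trans dist_fst_le dist_snd_le)+
  ultimately show
    "bounded_lipschitz I (dom B) (\<lambda>i. fst)"
    "bounded_lipschitz I (dom B) (\<lambda>i x. fst (snd x))"
    "bounded_lipschitz I (dom B) (\<lambda>i x. snd (snd x))"
    by (auto intro!: bounded_lipschitz_ident dist_fst_le)
qed

lemmas bl_intros = bounded_lipschitz_coefficients bounded_lipschitz_variables
  bounded_lipschitz_add bounded_lipschitz_diff bounded_lipschitz_mult bounded_lipschitz_Pair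

lemma bounded_lipschitz_rad: "bounded_lipschitz (index e) (dom B) (\<lambda>i. rad (fst i))"
  unfolding rad_def by (intro bl_intros)

lemma bounded_lipschitz_height: "bounded_lipschitz (index e) (dom B) (\<lambda>i. height (fst i) (snd i))"
  unfolding height_def by (intro bl_intros)

lemma bounded_lipschitz_pert: "bounded_lipschitz (index e) (dom B) (\<lambda>i. pert k (fst i) (snd i))"
  unfolding pert_def by (intro bl_intros bounded_lipschitz_rad bounded_lipschitz_height)

lemma bounded_lipschitz_radial: "bounded_lipschitz (index e) (dom B) (\<lambda>i. radial (fst i) (snd i))"
  unfolding radial_def by (intro bl_intros bounded_lipschitz_pert)

lemma bounded_lipschitz_angular: "bounded_lipschitz (index e) (dom B) (\<lambda>i. angular (fst i) (snd i))"
  unfolding angular_def by (intro bl_intros bounded_lipschitz_pert)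

lemma bounded_lipschitz_den: "bounded_lipschitz (index e) (dom B) (\<lambda>i. den (fst i) (snd i))"
  unfolding den_def by (intro bl_intros bounded_lipschitz_rad bounded_lipschitz_angular)

text \<open>Both quantities differ from \<rho> by \<epsilon> times something bounded, and \<rho>
  lies between \<open>\<rho>0 / 2\<close> and \<open>3 * \<rho>0 / 2\<close>, which leaves room for
  a deviation of \<open>\<rho>0 / 4\<close>.\<close>

lemma rad_den_bounds:
  obtains e where "e > 0"
    "\<And>\<epsilon> s p. \<bar>\<epsilon>\<bar> \<le> e \<Longrightarrow> s \<in> {0..2 * pi} \<Longrightarrow> p \<in> dom B \<Longrightarrow>
       rad \<epsilon> p \<in> {\<rho>0 / 4..2 * \<rho>0} \<and> den \<epsilon> s p \<in> {\<rho>0 / 4..2 * \<rho>0}"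
proof -
  have "bounded_lipschitz (index 1) (dom B)
      (\<lambda>i x. fst (snd x) + angular (fst i) (snd i) x)"
    by (intro bl_intros bounded_lipschitz_angular)
  then obtain A where "A \<ge> 0"
    and A: "\<And>i x. i \<in> index 1 \<Longrightarrow> x \<in> dom B \<Longrightarrow> norm (fst (snd x) + angular (fst i) (snd i) x) \<le> A"
    by (rule bounded_lipschitzE) blast
  \<comment> \<open>The cap 1 is there because \<open>A\<close> was obtained for
    \<open>index 1\<close>; the second term turns any factor up to
    \<open>A + \<bar>B\<bar> + 1\<close> into at most \<open>\<rho>0 / 4\<close>.\<close>
  define e where "e = min 1 (\<rho>0 / 4 / (A + \<bar>B\<bar> + 1))"
  show ?thesis
  proof (rule that[of e])
    show "e > 0" unfolding e_def using \<rho>0 \<open>A \<ge> 0\<close> by simp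
    fix \<epsilon> s p assume \<epsilon>: "\<bar>\<epsilon>\<bar> \<le> e" and s: "s \<in> {0..2 * pi}" and p: "p \<in> dom B"
    have small: "\<bar>\<epsilon> * x\<bar> \<le> \<rho>0 / 4" if "\<bar>x\<bar> \<le> A + \<bar>B\<bar> + 1" for x
    proof -
      have "\<bar>\<epsilon> * x\<bar> \<le> (\<rho>0 / 4 / (A + \<bar>B\<bar> + 1)) * (A + \<bar>B\<bar> + 1)"
        unfolding abs_mult using \<epsilon> that \<rho>0 \<open>A \<ge> 0\<close> by (intro mult_mono) (auto simp: e_def)
      also have "A + \<bar>B\<bar> + 1 \<noteq> 0" using \<open>A \<ge> 0\<close> by linarith
      then have "(\<rho>0 / 4 / (A + \<bar>B\<bar> + 1)) * (A + \<bar>B\<bar> + 1) = \<rho>0 / 4" by (metis divide_eq_eq)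
      finally show ?thesis .
    qed
    have "\<bar>fst (snd p)\<bar> \<le> norm (snd p)" using norm_fst_le[of "fst (snd p)" "snd (snd p)"] by simp
    moreover have "norm (snd p) \<le> B" using p by auto
    ultimately have "\<bar>\<epsilon> * fst (snd p)\<bar> \<le> \<rho>0 / 4" using \<open>A \<ge> 0\<close> by (intro small) auto
    moreover have "\<bar>\<epsilon> * (fst (snd p) + angular \<epsilon> s p)\<bar> \<le> \<rho>0 / 4"
    proof (rule small)
      have "(\<epsilon>, s) \<in> index 1" using \<epsilon> s by (auto simp: e_def abs_le_iff)
      from A[OF this p] show "\<bar>fst (snd p) + angular \<epsilon> s p\<bar> \<le> A + \<bar>B\<bar> + 1" by simp
    qed
    moreover have "\<bar>fst p - \<rho>0\<bar> \<le> \<rho>0 / 2" using p by (auto simp: dist_real_def abs_minus_commute)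
    ultimately show "rad \<epsilon> p \<in> {\<rho>0 / 4..2 * \<rho>0} \<and> den \<epsilon> s p \<in> {\<rho>0 / 4..2 * \<rho>0}"
      using \<rho>0 unfolding rad_def den_def distrib_left atLeastAtMost_iff by (intro conjI) linarith+
  qed
qed

text \<open>Everything is built from sums and products except the division by \<open>den\<close>,
  for which \<epsilon> has to be small depending on \<open>B\<close>.\<close>

lemma bounded_lipschitz_remainder:
  "\<exists>e>0. bounded_lipschitz (index e) (dom B) (\<lambda>(\<epsilon>, s). remainder \<epsilon> s)"
proof -
  obtain e where e: "e > 0"
    "\<And>\<epsilon> s p. \<bar>\<epsilon>\<bar> \<le> e \<Longrightarrow> s \<in> {0..2 * pi} \<Longrightarrow> p \<in> dom B \<Longrightarrow>
       rad \<epsilon> p \<in> {\<rho>0 / 4..2 * \<rho>0} \<and> den \<epsilon> s p \<in> {\<rho>0 / 4..2 * \<rho>0}"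
    by (rule rad_den_bounds) (rule that)
  have "bounded_lipschitz (index e) (dom B) (\<lambda>i x. inverse (den (fst i) (snd i) x))"
    by (rule bounded_lipschitz_inverse[OF bounded_lipschitz_den, of "\<rho>0 / 4"])
       (use e \<rho>0 in \<open>auto simp: abs_le_iff\<close>)
  then have "bounded_lipschitz (index e) (dom B) (\<lambda>i. remainder (fst i) (snd i))"
    unfolding remainder_def slope_def
    by (intro bl_intros bounded_lipschitz_radial bounded_lipschitz_angular bounded_lipschitz_pert)
  then show ?thesis using e(1) by (auto simp: case_prod_unfold)
qed

end

text \<open>
  \<open>rad / den\<close> is \<open>dt/d\<theta>\<close>, the inverse of the angular velocity \<open>1 + \<epsilon> angular / rad\<close>; it
  recovers the time \<open>t\<close> from the angle.
\<close>

lemma periodic_solution_of_polar: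
  fixes \<epsilon> \<rho> a b c :: real and Y :: "real \<Rightarrow> real \<times> real"
  defines "G \<equiv> \<lambda>s. c0 s + \<rho> *\<^sub>R c1 s + \<epsilon> *\<^sub>R remainder \<epsilon> s (\<rho>, Y s)"
    and "c \<equiv> exp (2 * pi) / (1 - exp (2 * pi))"
  assumes Y: "continuous_on UNIV Y" and a: "a > 0"
    and bounds: "\<And>s. s \<in> {0..2 * pi} \<Longrightarrow>
      rad \<epsilon> (\<rho>, Y s) \<in> {a..b} \<and> den \<epsilon> s (\<rho>, Y s) \<in> {a..b}"
    and G: "G integrable_on {0..2 * pi}" "fst (integral {0..2 * pi} G) = 0"
    and eq: "\<And>s. s \<in> {0..2 * pi} \<Longrightarrow>
      Y s = (0, c * snd (integral {0..2 * pi} G)) + integral {0..s} G"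
  obtains x where
    "periodic_solution (switched_field (linear_field \<epsilon> ap bp cp dp) (linear_field \<epsilon> am bm cm dm)) x"
    "x 0 = vector [\<rho>, 0, \<epsilon> * snd (Y 0)]"
proof -
  let ?F = "linear_field \<epsilon> ap bp cp dp" and ?G = "linear_field \<epsilon> am bm cm dm"
  define R where "R s = rad \<epsilon> (\<rho>, Y s)" for s
  define W where "W s = height \<epsilon> s (\<rho>, Y s)" for s
  define D where "D s = den \<epsilon> s (\<rho>, Y s)" for s
  define f where "f i s = pert i \<epsilon> s (\<rho>, Y s)" for i s
  define h where "h s = R s / D s" for s
  define X where "X s = (vector [R s * cos s, R s * sin s, W s] :: real^3)" for s
  note RD = bounds[folded R_def D_def]
  have b: "b \<ge> a" using RD[of 0] by simp
  have D_eq: "D s = R s + \<epsilon> * (cos s * f 2 s - sin s * f 1 s)" for s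
    by (simp add: D_def R_def f_def den_def angular_def)
  have YR: "R s = \<rho> + \<epsilon> * fst (Y s)" and YW: "W s = \<epsilon> * (exp s * snd (Y s))" for s
    by (simp_all add: R_def W_def rad_def height_def)
  have R_cont: "continuous_on S R" and W_cont: "continuous_on S W" for S
    unfolding YR YW using continuous_on_subset[OF Y, of S]
    by (auto intro!: continuous_intros)
  have X_cont: "continuous_on S X" for S
    unfolding X_def vector_3_eq by (intro continuous_intros R_cont W_cont)
  have G_eq: "G s = ((cos s * f 1 s + sin s * f 2 s) * h s,
      exp (- s) * (f 3 s * R s - W s * (cos s * f 2 s - sin s * f 1 s)) / D s)"
    if "s \<in> {0..2 * pi}" for s
    using polar_field_eq[of \<epsilon> s \<rho> "Y s"] RD[OF that] a
    by (simp add: G_def D_def R_def W_def h_def f_def radial_def angular_def)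

  have Y_isCont: "isCont Y s" for s
    using Y by (simp add: continuous_on_eq_continuous_at)
  have f_isCont: "isCont (f i) s" if "s \<noteq> pi" for i s
    unfolding f_def pert_def rad_def height_def fst_conv snd_conv
    using that by (intro continuous_intros isCont_half Y_isCont)
  have D_isCont: "isCont D s" if "s \<noteq> pi" for s
    unfolding D_eq YR using that by (intro continuous_intros f_isCont Y_isCont)
  have pos: "R s > 0" "D s > 0" if "s \<in> {0..2 * pi}" for s
    using RD[OF that] a by auto
  have h_isCont: "isCont h s" if "s \<in> {0<..<2 * pi} - {pi}" for s
    unfolding h_def YR using that pos[of s] by (intro continuous_intros D_isCont Y_isCont) auto
  have G_isCont: "isCont G s" if s: "s \<in> {0<..<2 * pi} - {pi}" for s
  proof -
    \<comment> \<open>\<open>G_eq\<close> holds for angles in \<open>{0..2 * pi}\<close>, so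
      continuity is transferred from the formula to \<open>G\<close> on a neighbourhood inside this
      interval.\<close>
    have "\<forall>\<^sub>F s in nhds s. s \<in> {0<..<2 * pi}"
      using s by (intro eventually_nhds_in_open) auto
    then have "\<forall>\<^sub>F s in nhds s. G s = ((cos s * f 1 s + sin s * f 2 s) * h s,
      exp (- s) * (f 3 s * R s - W s * (cos s * f 2 s - sin s * f 1 s)) / D s)"
      by (rule eventually_mono) (simp add: G_eq)
    moreover have "isCont (\<lambda>s. ((cos s * f 1 s + sin s * f 2 s) * h s,
      exp (- s) * (f 3 s * R s - W s * (cos s * f 2 s - sin s * f 1 s)) / D s)) s"
      unfolding YR YW using s pos[of s]
      by (intro continuous_intros f_isCont h_isCont D_isCont Y_isCont) auto
    ultimately show ?thesis by (simp add: isCont_cong)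
  qed

  have h_bounds: "a / b \<le> h s" "h s \<le> b / a" if "s \<in> {0..2 * pi}" for s
    unfolding h_def using RD[OF that] a by (auto intro!: frac_le)
  have h_int: "h integrable_on {0..2 * pi}"
  proof (rule bounded_measurable_integrable_on)
    show "h \<in> borel_measurable borel"
    proof -
      have [measurable]: "(\<lambda>s. fst (Y s)) \<in> borel_measurable borel"
        "(\<lambda>s. snd (Y s)) \<in> borel_measurable borel"
        using Y by (auto intro!: borel_measurable_continuous_onI continuous_intros)
      show ?thesis
        unfolding h_def D_eq R_def f_def pert_def rad_def height_def fst_conv snd_conv by measurable
    qed
    show "norm (h s) \<le> b / a" if "s \<in> {0..2 * pi}" for s
      using h_bounds[OF that] pos[OF that] by (simp add: h_def)
  qed
  define t where "t s = integral {0..s} h" for s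
  have t_der: "(t has_real_derivative h s) (at s)" if "s \<in> {0<..<2 * pi} - {pi}" for s
    unfolding has_real_derivative_iff_has_vector_derivative
    by (rule integral_equation_vector_derivative[OF _ h_int _ h_isCont[OF that], where c = 0])
       (use that in \<open>auto simp: t_def\<close>)
  have Y_der: "(Y has_vector_derivative G s) (at s)" if "s \<in> {0<..<2 * pi} - {pi}" for s
    by (rule integral_equation_vector_derivative[OF eq G(1) _ G_isCont[OF that]]) (use that in auto)
  have X_der: "(X has_vector_derivative h s *\<^sub>R half (?F (X s)) (?G (X s)) s) (at s)"
    if s: "s \<in> {0<..<2 * pi} - {pi}" for s
  proof -
    have s': "s \<in> {0..2 * pi}" using s by auto
    have h: "R s = h s * D s" using pos[OF s'] by (simp add: h_def)
    have "((\<lambda>s. fst (Y s)) has_real_derivative (cos s * f 1 s + sin s * f 2 s) * h s) (at s)"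
      using bounded_linear.has_vector_derivative[OF bounded_linear_fst Y_der[OF s]]
      by (simp add: has_real_derivative_iff_has_vector_derivative G_eq[OF s'])
    then have R_der: "(R has_real_derivative \<epsilon> * ((cos s * f 1 s + sin s * f 2 s) * h s)) (at s)"
      unfolding YR by (auto intro!: derivative_eq_intros)
    have "((\<lambda>s. snd (Y s)) has_real_derivative
        exp (- s) * (f 3 s * R s - W s * (cos s * f 2 s - sin s * f 1 s)) / D s) (at s)"
      using bounded_linear.has_vector_derivative[OF bounded_linear_snd Y_der[OF s]]
      by (simp add: has_real_derivative_iff_has_vector_derivative G_eq[OF s'])
    from DERIV_cmult[OF DERIV_mult[OF DERIV_exp this], of \<epsilon>]
    have "(W has_real_derivative W s +
        \<epsilon> * ((f 3 s * R s - W s * (cos s * f 2 s - sin s * f 1 s)) / D s)) (at s)"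
      unfolding YW[abs_def] by (rule DERIV_cong) (simp add: distrib_left exp_minus)
    moreover have "W s + \<epsilon> * ((f 3 s * R s - W s * (cos s * f 2 s - sin s * f 1 s)) / D s)
        = h s * (W s + \<epsilon> * f 3 s)"
    proof -
      \<comment> \<open>Inserting \<open>D = R + \<epsilon> * angular\<close> makes the two angular
        terms cancel.\<close>
      have "W s * D s + \<epsilon> * (f 3 s * R s - W s * (cos s * f 2 s - sin s * f 1 s))
          = R s * (W s + \<epsilon> * f 3 s)"
        unfolding D_eq by (simp add: algebra_simps)
      moreover have "W s = W s * D s / D s" using pos[OF s'] by simp
      ultimately show ?thesis
        by (metis add_divide_distrib h_def times_divide_eq_left times_divide_eq_right)
    qed
    ultimately have W_der: "(W has_real_derivative h s * (W s + \<epsilon> * f 3 s)) (at s)" by simp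
    have u: "((\<lambda>s. R s * cos s) has_real_derivative h s * (- (R s * sin s) + \<epsilon> * f 1 s)) (at s)"
    proof (rule DERIV_cong)
      show "((\<lambda>s. R s * cos s) has_real_derivative
          \<epsilon> * ((cos s * f 1 s + sin s * f 2 s) * h s) * cos s + - sin s * R s) (at s)"
        by (rule DERIV_mult[OF R_der DERIV_cos])
      \<comment> \<open>\<open>k\<close> and \<open>j\<close> stand for cosine and sine. With them
        as free variables the identity is purely algebraic, and the sum of squares becomes 1 only on
        instantiation.\<close>
      have "\<epsilon> * ((k * f 1 s + j * f 2 s) * h s) * k + - j * (h s * (R s + \<epsilon> * (k * f 2 s - j * f 1 s)))
          = h s * (- (R s * j) + \<epsilon> * (f 1 s * (j\<^sup>2 + k\<^sup>2)))" for j k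
        by (simp add: algebra_simps power2_eq_square)
      from this[of "cos s" "sin s", folded D_eq] show "\<epsilon> * ((cos s * f 1 s + sin s * f 2 s) * h s) * cos s + - sin s * R s
          = h s * (- (R s * sin s) + \<epsilon> * f 1 s)"
        by (simp add: h[symmetric])
    qed
    have v: "((\<lambda>s. R s * sin s) has_real_derivative h s * (R s * cos s + \<epsilon> * f 2 s)) (at s)"
    proof (rule DERIV_cong)
      show "((\<lambda>s. R s * sin s) has_real_derivative
          \<epsilon> * ((cos s * f 1 s + sin s * f 2 s) * h s) * sin s + cos s * R s) (at s)"
        by (rule DERIV_mult[OF R_der DERIV_sin])
      have "\<epsilon> * ((k * f 1 s + j * f 2 s) * h s) * j + k * (h s * (R s + \<epsilon> * (k * f 2 s - j * f 1 s)))
          = h s * (R s * k + \<epsilon> * (f 2 s * (j\<^sup>2 + k\<^sup>2)))" for j k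
        by (simp add: algebra_simps power2_eq_square)
      from this[of "cos s" "sin s", folded D_eq] show "\<epsilon> * ((cos s * f 1 s + sin s * f 2 s) * h s) * sin s + cos s * R s
          = h s * (R s * cos s + \<epsilon> * f 2 s)"
        by (simp add: h[symmetric])
    qed
    have "(X has_vector_derivative vector [h s * (- (R s * sin s) + \<epsilon> * f 1 s),
        h s * (R s * cos s + \<epsilon> * f 2 s), h s * (W s + \<epsilon> * f 3 s)]) (at s)"
      unfolding X_def vector_3_eq
      by (intro has_vector_derivative_add has_vector_derivative_scaleR[where g' = 0, simplified]
          has_vector_derivative_const u v W_der)
    moreover have "vector [h s * (- (R s * sin s) + \<epsilon> * f 1 s),
        h s * (R s * cos s + \<epsilon> * f 2 s), h s * (W s + \<epsilon> * f 3 s)]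
        = h s *\<^sub>R half (?F (X s)) (?G (X s)) s"
      by (simp add: vec_eq_iff forall_3 half_def linear_field_def Let_def X_def f_def pert_def
          R_def[symmetric] W_def[symmetric] algebra_simps)
    ultimately show ?thesis by simp
  qed
  have filippov: "half (?F (X s)) (?G (X s)) s \<in> filippov_map (switched_field ?F ?G) (X s)"
    if s: "s \<in> {0<..<2 * pi} - {pi}" for s
  proof (cases "s < pi")
    case True
    then have "X s $ 2 > 0" using s pos[of s] sin_gt_zero[of s] by (simp add: X_def)
    then show ?thesis
      using True by (simp add: filippov_map_switched_pos isCont_linear_field half_def)
  next
    case False
    then have "X s $ 2 < 0" using s pos[of s] sin_lt_zero[of s] by (simp add: X_def mult_pos_neg)
    then show ?thesis
      using False s by (simp add: filippov_map_switched_neg isCont_linear_field half_def)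
  qed
  obtain C1 where C1: "\<And>s. s \<in> {0..2 * pi} \<Longrightarrow> norm (?F (X s)) \<le> C1"
    using compact_imp_bounded[OF compact_continuous_image[OF
        continuous_on_compose2[OF continuous_on_linear_field[of UNIV] X_cont] compact_Icc]]
    by (fastforce simp: bounded_iff)
  obtain C2 where C2: "\<And>s. s \<in> {0..2 * pi} \<Longrightarrow> norm (?G (X s)) \<le> C2"
    using compact_imp_bounded[OF compact_continuous_image[OF
        continuous_on_compose2[OF continuous_on_linear_field[of UNIV] X_cont] compact_Icc]]
    by (fastforce simp: bounded_iff)
  define z where "z = snd (integral {0..2 * pi} G)"
  have Y0: "Y 0 = (0, c * z)" and Y\<tau>: "Y (2 * pi) = (0, c * z + z)"
    using eq[of 0] eq[of "2 * pi"] G(2) by (auto simp: z_def prod_eq_iff)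
  \<comment> \<open>This equation is the origin of \<open>c\<close>: it says that w returns to its
    initial value after one turn.\<close>
  have "exp (2 * pi) * (c * z + z) = c * z"
  proof -
    have "exp (2 * pi) \<noteq> 1" by simp
    then show ?thesis unfolding c_def by (simp add: field_simps)
  qed
  then have X_closed: "X 0 = X (2 * pi)"
    by (simp add: X_def YR YW Y0 Y\<tau>)
  show ?thesis
  proof (rule periodic_solution_reparametrized[where \<tau> = "2 * pi" and K = "{pi}" and X = X
        and t = t and m = "a / b" and C = "max 0 (max C1 C2)" and h = h and r = pi
        and f = "switched_field ?F ?G" and y = "\<lambda>s. half (?F (X s)) (?G (X s)) s"])
    show "continuous_on {0..2 * pi} t"
      unfolding t_def by (intro indefinite_integral_continuous_1 h_int)
    show "half (?F (X s)) (?G (X s)) s \<in> filippov_map (switched_field ?F ?G) (X s) \<and>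
        norm (half (?F (X s)) (?G (X s)) s) \<le> max 0 (max C1 C2)"
      if "s \<in> {0<..<2 * pi} - {pi}" for s
      using C1[of s] C2[of s] filippov[OF that] that by (auto simp: half_def)
    \<comment> \<open>After half a turn u is negative, while it is positive at the start.\<close>
    show "X pi \<noteq> X 0"
    proof
      assume "X pi = X 0"
      then have "X pi $ 1 = X 0 $ 1" by simp
      then show False using pos[of 0] pos[of pi] by (simp add: X_def)
    qed
    fix x assume x: "periodic_solution (switched_field ?F ?G) x" "x 0 = X 0"
    show thesis by (rule that[OF x(1)]) (simp add: x(2) X_def YR YW Y0)
  qed (use a b h_bounds t_der X_der X_cont X_closed in \<open>auto simp: t_def\<close>)
qed

section \<open>Averages over one turn\<close>

lemma has_integral_cos_sin:
  "l \<le> u \<Longrightarrow> ((\<lambda>s. cos s * p + sin s * q) has_integral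
     (sin u * p - cos u * q) - (sin l * p - cos l * q)) {l..u}" for l u p q :: real
  by (rule fundamental_theorem_of_calculus)
     (auto intro!: derivative_eq_intros simp: has_real_derivative_iff_has_vector_derivative[symmetric])

lemma has_integral_quadratic_cos_sin:
  fixes b1 c1 b2 c2 :: real
  defines "F \<equiv> \<lambda>s. b1 * (s + sin s * cos s) / 2 + (c1 + b2) * (sin s)\<^sup>2 / 2
                   + c2 * (s - sin s * cos s) / 2"
  assumes "l \<le> u"
  shows "((\<lambda>s. cos s * (b1 * cos s + c1 * sin s) + sin s * (b2 * cos s + c2 * sin s))
     has_integral F u - F l) {l..u}"
proof (rule fundamental_theorem_of_calculus[OF \<open>l \<le> u\<close>])
  fix s :: real
  \<comment> \<open>The integrand and the derivative of \<open>F\<close> differ by a multiple of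
    \<open>j\<^sup>2 + k\<^sup>2 - 1\<close>, which vanishes for sine and cosine.\<close>
  have "k * (b1 * k + c1 * j) + j * (b2 * k + c2 * j)
      - (b1 * (1 + (k * k - j * j)) / 2 + (c1 + b2) * (2 * j * k) / 2 + c2 * (1 - (k * k - j * j)) / 2)
      = (b1 + c2) / 2 * (j\<^sup>2 + k\<^sup>2 - 1)" for j k :: real
    by (simp add: field_simps power2_eq_square)
  from this[of "cos s" "sin s"] have "b1 * (1 + (cos s * cos s - sin s * sin s)) / 2 + (c1 + b2) * (2 * sin s * cos s) / 2
      + c2 * (1 - (cos s * cos s - sin s * sin s)) / 2
      = cos s * (b1 * cos s + c1 * sin s) + sin s * (b2 * cos s + c2 * sin s)"
    by simp
  moreover have "(F has_real_derivative
      b1 * (1 + (cos s * cos s - sin s * sin s)) / 2 + (c1 + b2) * (2 * sin s * cos s) / 2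
      + c2 * (1 - (cos s * cos s - sin s * sin s)) / 2) (at s within {l..u})"
    unfolding F_def by (auto intro!: derivative_eq_intros simp: field_simps)
  ultimately show "(F has_vector_derivative
      cos s * (b1 * cos s + c1 * sin s) + sin s * (b2 * cos s + c2 * sin s)) (at s within {l..u})"
    by (simp add: has_real_derivative_iff_has_vector_derivative)
qed

lemma coefficients_bounded:
  obtains C where "\<And>s. s \<in> {0..2 * pi} \<Longrightarrow> norm (c0 s) \<le> C \<and> norm (c1 s) \<le> C"
proof -
  \<comment> \<open>The calculus of bounded families is reused just for its bound, with \<epsilon> =
    0 and a one-point domain.\<close>
  have "bounded_lipschitz (index 0) {0 :: real} (\<lambda>i x. (c0 (snd i), c1 (snd i)))"
    unfolding c0_def c1_def slope_def
    by (intro bounded_lipschitz_coefficients bounded_lipschitz_add bounded_lipschitz_mult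
        bounded_lipschitz_Pair)
  then obtain C where C: "\<And>i x. i \<in> index 0 \<Longrightarrow> x \<in> {0 :: real} \<Longrightarrow> norm (c0 (snd i), c1 (snd i)) \<le> C"
    by (rule bounded_lipschitzE) blast
  show ?thesis
  proof (rule that[of C])
    fix s assume "s \<in> {0..2 * pi}"
    then have "norm (c0 s, c1 s) \<le> C" using C[of "(0, s)" 0] by simp
    then show "norm (c0 s) \<le> C \<and> norm (c1 s) \<le> C"
      using norm_fst_le[of "c0 s" "c1 s"] norm_snd_le[of "c1 s" "c0 s"] by linarith
  qed
qed

lemma coefficients_integrable: "c0 integrable_on {0..2 * pi}" "c1 integrable_on {0..2 * pi}"
proof -
  obtain C where C: "\<And>s. s \<in> {0..2 * pi} \<Longrightarrow> norm (c0 s) \<le> C \<and> norm (c1 s) \<le> C"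
    by (rule coefficients_bounded) blast
  have "c0 \<in> borel_measurable borel" "c1 \<in> borel_measurable borel"
    unfolding c0_def[abs_def] c1_def[abs_def] slope_def by (intro borel_measurable_Pair; measurable)+
  then show "c0 integrable_on {0..2 * pi}" "c1 integrable_on {0..2 * pi}"
    using C by (auto intro!: bounded_measurable_integrable_on[where B = C])
qed

text \<open>Over each half-turn the integrals of cos and of sin cos vanish, those of the squares are
  \<pi>/2, and sin gives 2 and then -2. Hence the jump of a2 and the sum of the b1 and c2 are all
  that survives.\<close>

lemma averages:
  "fst (integral {0..2 * pi} c0) = 2 * (ap$2 - am$2)"
  "fst (integral {0..2 * pi} c1) = pi / 2 * (bm$1 + bp$1 + cm$2 + cp$2)"
proof -
  have fst: "fst (integral {0..2 * pi} g) = integral {0..2 * pi} (\<lambda>s. fst (g s))"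
    if "g integrable_on {0..2 * pi}" for g :: "real \<Rightarrow> real \<times> real"
    using integral_linear[OF that bounded_linear_fst] by (simp add: o_def)
  have "(\<lambda>s. fst (c0 s)) = (\<lambda>s. half (cos s * ap$1 + sin s * ap$2) (cos s * am$1 + sin s * am$2) s)"
    by (auto simp: c0_def half_def)
  then have "((\<lambda>s. fst (c0 s)) has_integral 2 * (ap$2 - am$2)) {0..2 * pi}"
    using has_integral_half[OF has_integral_cos_sin[of 0 pi "ap$1" "ap$2"]
        has_integral_cos_sin[of pi "2 * pi" "am$1" "am$2"]]
    by simp
  then show "fst (integral {0..2 * pi} c0) = 2 * (ap$2 - am$2)"
    by (simp add: fst coefficients_integrable integral_unique)
  have "(\<lambda>s. fst (c1 s)) = (\<lambda>s. half
      (cos s * (bp$1 * cos s + cp$1 * sin s) + sin s * (bp$2 * cos s + cp$2 * sin s))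
      (cos s * (bm$1 * cos s + cm$1 * sin s) + sin s * (bm$2 * cos s + cm$2 * sin s)) s)"
    by (auto simp: c1_def slope_def half_def)
  then have "((\<lambda>s. fst (c1 s)) has_integral pi / 2 * (bm$1 + bp$1 + cm$2 + cp$2)) {0..2 * pi}"
    using has_integral_half[OF
        has_integral_quadratic_cos_sin[of 0 pi "bp$1" "cp$1" "bp$2" "cp$2"]
        has_integral_quadratic_cos_sin[of pi "2 * pi" "bm$1" "cm$1" "bm$2" "cm$2"]]
    by (simp add: algebra_simps add_divide_distrib)
  then show "fst (integral {0..2 * pi} c1) = pi / 2 * (bm$1 + bp$1 + cm$2 + cp$2)"
    by (simp add: fst coefficients_integrable integral_unique)
qed

section \<open>Existence for all small \<epsilon>, with a linear rate\<close>

lemma periodic_family: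
  fixes \<rho>0 :: real
  assumes \<rho>0: "\<rho>0 = 4 * (am$2 - ap$2) / (pi * (bm$1 + bp$1 + cm$2 + cp$2))" "\<rho>0 > 0"
  obtains e B where "e > 0" "\<And>\<epsilon>. \<bar>\<epsilon>\<bar> < e \<Longrightarrow> \<exists>x.
      periodic_solution (switched_field (linear_field \<epsilon> ap bp cp dp) (linear_field \<epsilon> am bm cm dm)) x \<and>
      \<bar>x 0 $ 1 - \<rho>0\<bar> \<le> B * \<bar>\<epsilon>\<bar> \<and> x 0 $ 2 = 0 \<and> \<bar>x 0 $ 3\<bar> \<le> B * \<bar>\<epsilon>\<bar>"
proof -
  let ?S = "bm$1 + bp$1 + cm$2 + cp$2"
  define c :: real where "c = exp (2 * pi) / (1 - exp (2 * pi))"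
  have S: "?S \<noteq> 0" using \<rho>0 by auto
  obtain C where C: "\<And>s. s \<in> {0..2 * pi} \<Longrightarrow> norm (c0 s) \<le> C \<and> norm (c1 s) \<le> C"
    by (rule coefficients_bounded) blast
  obtain \<epsilon>0 B where "\<epsilon>0 > 0" and sol: "\<And>\<epsilon>. \<bar>\<epsilon>\<bar> < \<epsilon>0 \<Longrightarrow> \<exists>\<rho> Y. \<bar>\<rho> - \<rho>0\<bar> \<le> \<rho>0 / 2 \<and>
      \<bar>\<rho> - \<rho>0\<bar> \<le> B * \<bar>\<epsilon>\<bar> \<and> continuous_on UNIV Y \<and> (\<forall>s. norm (Y s) \<le> B) \<and>
      (let G = (\<lambda>s. c0 s + \<rho> *\<^sub>R c1 s + \<epsilon> *\<^sub>R remainder \<epsilon> s (\<rho>, Y s)) in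
         G integrable_on {0..2 * pi} \<and> fst (integral {0..2 * pi} G) = 0 \<and>
         (\<forall>s\<in>{0..2 * pi}. Y s = (0, c * snd (integral {0..2 * pi} G)) + integral {0..s} G))"
  \<comment> \<open>\<open>fst\<close> expresses y(2\<pi>) = y(0). \<open>M\<close> sets y(0) = 0
    and gives z the initial value for which the orbit closes in w.\<close>
  proof (rule averaged_boundary_value_problem[where \<tau> = "2 * pi" and \<phi> = fst
        and M = "\<lambda>v. (0, c * snd v)" and \<delta> = "\<rho>0 / 2" and ?\<rho>0.0 = \<rho>0 and \<alpha> = "pi / 2 * ?S" and ?C1.0 = C
        and ?c0.0 = c0 and ?c1.0 = c1 and N = remainder])
    show "bounded_linear (\<lambda>v :: real \<times> real. (0 :: real, c * snd v))"
      by (intro bounded_linear_intros)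
    show "fst (integral {0..2 * pi} c0) + \<rho>0 * (pi / 2 * ?S) = 0"
    proof -
      have "\<rho>0 * (pi * ?S) = 4 * (am$2 - ap$2)" using S \<rho>0(1) by simp
      then have "\<rho>0 * (pi / 2 * ?S) = 2 * (am$2 - ap$2)" by simp
      then show ?thesis unfolding averages by argo
    qed
  qed (use C S \<rho>0(2) in \<open>auto intro: bounded_linear_fst coefficients_integrable
         borel_measurable_remainder bounded_lipschitz_remainder simp: averages\<close>)
  \<comment> \<open>The bound \<open>B\<close> on \<open>Y\<close> is available only now; it
    determines how small \<epsilon> must be for the polar coordinates to stay valid along the
    orbit.\<close>
  obtain e where e: "e > 0" "\<And>\<epsilon> s p. \<bar>\<epsilon>\<bar> \<le> e \<Longrightarrow> s \<in> {0..2 * pi} \<Longrightarrow>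
      p \<in> cball \<rho>0 (\<rho>0 / 2) \<times> cball 0 B \<Longrightarrow>
      rad \<epsilon> p \<in> {\<rho>0 / 4..2 * \<rho>0} \<and> den \<epsilon> s p \<in> {\<rho>0 / 4..2 * \<rho>0}"
    using rad_den_bounds[OF \<rho>0(2), of B] by blast
  show ?thesis
  proof (rule that[of "min \<epsilon>0 e" B])
    show "min \<epsilon>0 e > 0" using \<open>\<epsilon>0 > 0\<close> e(1) by simp
    fix \<epsilon> :: real assume \<epsilon>: "\<bar>\<epsilon>\<bar> < min \<epsilon>0 e"
    then obtain \<rho> Y where \<rho>: "\<bar>\<rho> - \<rho>0\<bar> \<le> \<rho>0 / 2" "\<bar>\<rho> - \<rho>0\<bar> \<le> B * \<bar>\<epsilon>\<bar>"
      and Y: "continuous_on UNIV Y" "\<And>s. norm (Y s) \<le> B"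
      and G: "let G = (\<lambda>s. c0 s + \<rho> *\<^sub>R c1 s + \<epsilon> *\<^sub>R remainder \<epsilon> s (\<rho>, Y s)) in
         G integrable_on {0..2 * pi} \<and> fst (integral {0..2 * pi} G) = 0 \<and>
         (\<forall>s\<in>{0..2 * pi}. Y s = (0, c * snd (integral {0..2 * pi} G)) + integral {0..s} G)"
      using sol[of \<epsilon>] by auto
    have dom: "(\<rho>, Y s) \<in> cball \<rho>0 (\<rho>0 / 2) \<times> cball 0 B" for s
      using \<rho>(1) Y(2)[of s] by (auto simp: dist_real_def abs_minus_commute)
    obtain x where x:
      "periodic_solution (switched_field (linear_field \<epsilon> ap bp cp dp) (linear_field \<epsilon> am bm cm dm)) x"
      "x 0 = vector [\<rho>, 0, \<epsilon> * snd (Y 0)]"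
    proof (rule periodic_solution_of_polar[of Y "\<rho>0 / 4" \<epsilon> \<rho> "2 * \<rho>0"])
      show "rad \<epsilon> (\<rho>, Y s) \<in> {\<rho>0 / 4..2 * \<rho>0} \<and> den \<epsilon> s (\<rho>, Y s) \<in> {\<rho>0 / 4..2 * \<rho>0}"
        if "s \<in> {0..2 * pi}" for s
        using e(2)[OF _ that dom] \<epsilon> by simp
    qed (use Y(1) \<rho>0(2) G[unfolded Let_def c_def] in \<open>(simp | blast)+\<close>)
    have "\<bar>snd (Y 0)\<bar> \<le> B"
      using Y(2)[of 0] norm_snd_le[of "snd (Y 0)" "fst (Y 0)"] by simp
    then have "\<bar>\<epsilon>\<bar> * \<bar>snd (Y 0)\<bar> \<le> \<bar>\<epsilon>\<bar> * B" by (intro mult_left_mono) auto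
    then have "\<bar>x 0 $ 1 - \<rho>0\<bar> \<le> B * \<bar>\<epsilon>\<bar> \<and> x 0 $ 2 = 0 \<and> \<bar>x 0 $ 3\<bar> \<le> B * \<bar>\<epsilon>\<bar>"
      using \<rho>(2) by (simp add: x(2) abs_mult mult.commute)
    with x(1) show "\<exists>x.
      periodic_solution (switched_field (linear_field \<epsilon> ap bp cp dp) (linear_field \<epsilon> am bm cm dm)) x \<and>
      \<bar>x 0 $ 1 - \<rho>0\<bar> \<le> B * \<bar>\<epsilon>\<bar> \<and> x 0 $ 2 = 0 \<and> \<bar>x 0 $ 3\<bar> \<le> B * \<bar>\<epsilon>\<bar>" by blast
  qed
qed

end

theorem proposition1:
  fixes ap bp cp dp am bm cm dm :: "real^3"
  assumes "(am$2 - ap$2) * (bm$1 + bp$1 + cm$2 + cp$2) > 0"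
  shows "\<exists>\<epsilon>\<^sub>0>0. \<exists>x :: real \<Rightarrow> real \<Rightarrow> real^3.
           (\<forall>\<epsilon>. 0 < \<bar>\<epsilon>\<bar> \<and> \<bar>\<epsilon>\<bar> < \<epsilon>\<^sub>0 \<longrightarrow>
              periodic_solution
                (switched_field (linear_field \<epsilon> ap bp cp dp) (linear_field \<epsilon> am bm cm dm))
                (\<lambda>t. x t \<epsilon>)) \<and>
           ((\<lambda>\<epsilon>. x 0 \<epsilon> $ 3) \<longlongrightarrow> 0) (at 0) \<and>
           (\<exists>us vs :: real.
              norm (us, vs) = 4 * (am$2 - ap$2) / (pi * (bm$1 + bp$1 + cm$2 + cp$2)) \<and>
              ((\<lambda>\<epsilon>. (x 0 \<epsilon> $ 1, x 0 \<epsilon> $ 2)) \<longlongrightarrow> (us, vs)) (at 0))"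
proof -
  define \<rho>0 where "\<rho>0 = 4 * (am$2 - ap$2) / (pi * (bm$1 + bp$1 + cm$2 + cp$2))"
  have "\<rho>0 > 0"
    using assms unfolding \<rho>0_def by (auto simp: zero_less_mult_iff zero_less_divide_iff mult_less_0_iff)
  then obtain e B where "e > 0" and ex: "\<And>\<epsilon>. \<bar>\<epsilon>\<bar> < e \<Longrightarrow> \<exists>x.
      periodic_solution (switched_field (linear_field \<epsilon> ap bp cp dp) (linear_field \<epsilon> am bm cm dm)) x \<and>
      \<bar>x 0 $ 1 - \<rho>0\<bar> \<le> B * \<bar>\<epsilon>\<bar> \<and> x 0 $ 2 = 0 \<and> \<bar>x 0 $ 3\<bar> \<le> B * \<bar>\<epsilon>\<bar>"
    using periodic_family[OF \<rho>0_def, of dp dm] by blast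
  then obtain x where x: "\<And>\<epsilon>. \<bar>\<epsilon>\<bar> < e \<Longrightarrow>
      periodic_solution (switched_field (linear_field \<epsilon> ap bp cp dp) (linear_field \<epsilon> am bm cm dm)) (x \<epsilon>)"
    "\<And>\<epsilon>. \<bar>\<epsilon>\<bar> < e \<Longrightarrow> \<bar>x \<epsilon> 0 $ 1 - \<rho>0\<bar> \<le> B * \<bar>\<epsilon>\<bar> \<and> x \<epsilon> 0 $ 2 = 0 \<and> \<bar>x \<epsilon> 0 $ 3\<bar> \<le> B * \<bar>\<epsilon>\<bar>"
    by metis
  have near: "\<forall>\<^sub>F \<epsilon> in at 0. \<bar>\<epsilon>\<bar> < e"
    using \<open>e > 0\<close> unfolding eventually_at by (intro exI[of _ e]) auto
  have small: "((\<lambda>\<epsilon>. B * \<bar>\<epsilon>\<bar>) \<longlongrightarrow> 0) (at 0)" by (auto intro!: tendsto_eq_intros)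
  have "((\<lambda>\<epsilon>. x \<epsilon> 0 $ 1 - \<rho>0) \<longlongrightarrow> 0) (at 0)"
    by (rule Lim_null_comparison[OF eventually_mono[OF near] small]) (simp add: x(2))
  then have u: "((\<lambda>\<epsilon>. x \<epsilon> 0 $ 1) \<longlongrightarrow> \<rho>0) (at 0)" by (rule LIM_zero_cancel)
  have v: "((\<lambda>\<epsilon>. x \<epsilon> 0 $ 2) \<longlongrightarrow> 0) (at 0)"
    by (rule tendsto_eventually[OF eventually_mono[OF near]]) (simp add: x(2))
  have w: "((\<lambda>\<epsilon>. x \<epsilon> 0 $ 3) \<longlongrightarrow> 0) (at 0)"
    by (rule Lim_null_comparison[OF eventually_mono[OF near] small]) (simp add: x(2))
  show ?thesis
  proof (intro exI conjI allI impI)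
    show "e > 0" by fact
    show "periodic_solution (switched_field (linear_field \<epsilon> ap bp cp dp) (linear_field \<epsilon> am bm cm dm))
        (\<lambda>t. x \<epsilon> t)" if "0 < \<bar>\<epsilon>\<bar> \<and> \<bar>\<epsilon>\<bar> < e" for \<epsilon>
      using x(1)[of \<epsilon>] that by simp
    show "((\<lambda>\<epsilon>. x \<epsilon> 0 $ 3) \<longlongrightarrow> 0) (at 0)" by (rule w)
    show "norm (\<rho>0, 0 :: real) = 4 * (am$2 - ap$2) / (pi * (bm$1 + bp$1 + cm$2 + cp$2))"
      unfolding \<rho>0_def[symmetric] using \<open>\<rho>0 > 0\<close> by (simp add: norm_Pair)
    \<comment> \<open>The orbits start at angle 0, on the plane v = 0 with u > 0, so the limit point
      is \<open>(\<rho>0, 0)\<close> and its norm is \<open>\<rho>0\<close>.\<close>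
    show "((\<lambda>\<epsilon>. (x \<epsilon> 0 $ 1, x \<epsilon> 0 $ 2)) \<longlongrightarrow> (\<rho>0, 0)) (at 0)"
      by (rule tendsto_Pair[OF u v])
  qed
qed

end
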